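(* Let $q$ be a prime power and let $\mathcal{V}$ be an intersecting $k$-Sperner family of subspaces of $\mathbb{F}_q^n$. For $0 \leq j \leq n$ let $\mathcal{V}_j = \{V \in \mathcal{V} : \dim(V) = j\}$. If $\dim(V) \leq \lfloor n/2 \rfloor$ for each $V \in \mathcal{V}$, then \[\sum_{j=1}^{\lfloor n/2 \rfloor} \frac{|\mathcal{V}_j|}{\genfrac{[}{]}{0pt}{}{n-1}{j-1}} \leq k.\]
   Context: $\genfrac{[}{]}{0pt}{}{n}{k} = \prod_{0 \leq i \leq k-1}\frac{q^{n-i}-1}{q^{k-i}-1}$ is the Gaussian coefficient. A family of subspaces is intersecting if $\dim(V \cap W) > 0$ for every pair of distinct members $V, W$. A family is $k$-Sperner if every chain (subfamily totally ordered by inclusion) in it has at most $k$ members. *)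

theory Defs
  imports "HOL-Analysis.Analysis"
begin

(* For n < k the truncated exponents are harmless: the factor with i = n is zero,
   so the product is zero, as it should be. *)
definition gauss_coeff :: "nat \<Rightarrow> nat \<Rightarrow> nat \<Rightarrow> real" where
  "gauss_coeff q n k = (\<Prod>i<k. (real q ^ (n - i) - 1) / (real q ^ (k - i) - 1))"

definition intersecting :: "('a::field ^ 'n) set set \<Rightarrow> bool" where
  "intersecting \<V> \<longleftrightarrow> pairwise (\<lambda>V W. vec.dim (V \<inter> W) > 0) \<V>"

(* Finiteness is required explicitly because card is 0 on infinite sets. *)
definition k_Sperner :: "nat \<Rightarrow> 'a set set \<Rightarrow> bool" where
  "k_Sperner k \<F> \<longleftrightarrow> (\<forall>\<C>\<in>chains \<F>. finite \<C> \<and> card \<C> \<le> k)"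

definition dim_level :: "('a::field ^ 'n) set set \<Rightarrow> nat \<Rightarrow> ('a ^ 'n) set set" where
  "dim_level \<V> j = {V \<in> \<V>. vec.dim V = j}"

end

theory Submission
  imports Defs "HOL-Algebra.Algebraic_Closure_Type"
begin

text \<open>
  Write \<open>[m] = 1 + q + \<dots> + q^(m-1)\<close>, and measure a family of \<open>d\<close>-subspaces by its
  density \<open>\<mu>\<close> among all \<open>d\<close>-subspaces; the term of the sum for dimension \<open>j\<close> is then
  \<open>\<mu> [n] / [j]\<close>. Removing minimal members \<open>k\<close> times reduces the claim to antichains.

  The spectral gap of the Grassmann graph (proved by induction on \<open>d\<close> from the commutation
  relation of the up and down operators) gives, with Cauchy-Schwarz, a lower bound on the density
  \<open>\<mu>'\<close> of the upper shadow of a family of density \<open>\<mu>\<close> that is sharp for the family of all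
  \<open>d\<close>-subspaces through a point, where \<open>\<mu> = [d]/[n]\<close>. Hence \<open>\<mu>'/[d+1] \<ge> \<mu>/[d]\<close>
  if \<open>\<mu> \<le> [d]/[n]\<close>, whereas \<open>\<mu> > [d]/[n]\<close> propagates to \<open>\<mu>' > [d+1]/[n]\<close>.

  The second alternative is impossible for an intersecting family of \<open>j\<close>-subspaces with
  \<open>l = n - j \<ge> j\<close>. The nonzero vectors of the whole space are partitioned by one
  \<open>l\<close>-subspace and \<open>q^l\<close> \<open>j\<close>-subspaces (coming from the field with \<open>q^l\<close> elements). An image of
  this partition under a linear automorphism contains at most one member of the family or of its
  upper shadow in dimension \<open>l\<close>. Averaging gives \<open>q^l \<mu> + \<mu>' \<le> 1\<close>, where \<open>\<mu>'\<close> is the density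
  of that shadow, while \<open>\<mu> > [j]/[n]\<close> and \<open>\<mu>' > [l]/[n]\<close> would make the left side exceed \<open>1\<close>.

  So the first alternative always holds, and replacing the lowest level of an intersecting
  antichain by its upper shadow does not decrease the sum; only the level \<open>n div 2\<close>
  remains in the end.
\<close>

section \<open>Counting subspaces\<close>

text \<open>A sum instead of the quotient (q^m - 1)/(q - 1), so that the recursions hold for every q
  without a division. It is the number of points of an m-dimensional space.\<close>

definition qnum :: "nat \<Rightarrow> nat \<Rightarrow> real" where
  "qnum q m = (\<Sum>i<m. real q ^ i)"

lemma qnum_0 [simp]: "qnum q 0 = 0"
  by (simp add: qnum_def)

lemma qnum_1 [simp]: "qnum q (Suc 0) = 1"
  by (simp add: qnum_def)

lemma qnum_mult_diff: "qnum q m * (real q - 1) = real q ^ m - 1"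
  by (simp add: qnum_def power_diff_1_eq mult.commute)

lemma qnum_Suc: "qnum q (Suc m) = 1 + real q * qnum q m"
  unfolding qnum_def by (subst sum.lessThan_Suc_shift) (simp add: sum_distrib_left)

lemma qnum_add: "qnum q (a + b) = qnum q a + real q ^ a * qnum q b"
  by (induction a) (simp_all add: qnum_Suc algebra_simps)

lemma qnum_nonneg [simp]: "qnum q m \<ge> 0"
  by (simp add: qnum_def sum_nonneg)

lemma qnum_pos: "m > 0 \<Longrightarrow> qnum q m > 0"
  by (cases m) (auto simp: qnum_Suc intro!: add_pos_nonneg)

text \<open>Each new basis vector multiplies the size of the span by the number of scalars, since
  the decomposition into a multiple of \<open>b\<close> and an element of the old span is unique.
  The abstract setting serves both F_q^n and the algebraic closure as spaces over F_q.\<close>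

lemma (in vector_space) card_span_independent:
  assumes fin: "finite (UNIV :: 'a set)" and "finite B" and "independent B"
  shows "finite (span B) \<and> card (span B) = CARD('a) ^ card B"
  using assms(2,3)
proof (induction B rule: finite_induct)
  case empty
  then show ?case by simp
next
  case (insert b B)
  then have ind: "independent B" and b: "b \<notin> span B"
    by (auto simp: independent_insert split: if_splits)
  have IH: "finite (span B)" "card (span B) = CARD('a) ^ card B"
    using insert.IH ind by auto
  have "bij_betw (\<lambda>(c, v). scale c b + v) (UNIV \<times> span B) (span (insert b B))"
    unfolding bij_betw_def
  proof
    show "inj_on (\<lambda>(c, v). scale c b + v) (UNIV \<times> span B)"
    proof (rule inj_onI, clarsimp)
      fix c v c' v'
      assume v: "v \<in> span B" "v' \<in> span B" and eq: "scale c b + v = scale c' b + v'"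
      then have "scale (c - c') b = v' - v"
        by (simp add: scale_left_diff_distrib algebra_simps)
      then have *: "scale (c - c') b \<in> span B"
        using v by (simp add: span_diff)
      have "c = c'"
      proof (rule ccontr)
        assume "c \<noteq> c'"
        then have "b = scale (inverse (c - c')) (scale (c - c') b)" by simp
        then show False using b * by (metis span_scale)
      qed
      then show "c = c' \<and> v = v'" using eq by simp
    qed
    show "(\<lambda>(c, v). scale c b + v) ` (UNIV \<times> span B) = span (insert b B)"
    proof (rule Set.set_eqI)
      fix x
      show "x \<in> (\<lambda>(c, v). scale c b + v) ` (UNIV \<times> span B) \<longleftrightarrow> x \<in> span (insert b B)"
      proof
        assume "x \<in> span (insert b B)"
        then obtain k where "x - scale k b \<in> span B" by (auto simp: span_insert)
        then show "x \<in> (\<lambda>(c, v). scale c b + v) ` (UNIV \<times> span B)"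
          by (intro image_eqI[of _ _ "(k, x - scale k b)"]) auto
      next
        assume "x \<in> (\<lambda>(c, v). scale c b + v) ` (UNIV \<times> span B)"
        then obtain c v where x: "x = scale c b + v" "v \<in> span B" by auto
        then have "x - scale c b \<in> span B" by simp
        then show "x \<in> span (insert b B)" by (auto simp: span_insert)
      qed
    qed
  qed
  then have "card (span (insert b B)) = card ((UNIV :: 'a set) \<times> span B)"
    and "finite (span (insert b B)) = finite ((UNIV :: 'a set) \<times> span B)"
    by (simp_all add: bij_betw_same_card bij_betw_finite)
  then show ?case
    using IH fin insert.hyps by (simp add: card_cartesian_product)
qed

lemma card_subspace:
  fixes V :: "('a::{field,finite} ^ 'n) set"
  assumes "vec.subspace V"
  shows "card V = CARD('a) ^ vec.dim V"
proof -
  obtain B where "B \<subseteq> V" "vec.independent B" "V \<subseteq> vec.span B" "card B = vec.dim V"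
    using vec.basis_exists by blast
  moreover from this have "vec.span B = V"
    using assms by (simp add: vec.span_subspace)
  ultimately show ?thesis
    using vec.card_span_independent[of B] by auto
qed

lemma card_field_ge_2: "CARD('a::{field,finite}) \<ge> 2"
proof -
  have "card {0, 1 :: 'a} \<le> CARD('a)" by (rule card_mono) auto
  then show ?thesis by simp
qed

definition level :: "nat \<Rightarrow> ('a::field ^ 'n) set set" where
  "level d = {V. vec.subspace V \<and> vec.dim V = d}"

text \<open>The span of \<open>v\<close> and \<open>V\<close> lies in \<open>W\<close> and already
  has dimension d + 1. Hence the differences W - V, for the covers \<open>W\<close> of
  \<open>V\<close>, are pairwise disjoint.\<close>

lemma level_unique_super:
  fixes V :: "('a::field ^ 'n) set"
  assumes "V \<in> level d" "W \<in> level (Suc d)" "V \<subseteq> W" "v \<in> W" "v \<notin> V"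
  shows "W = vec.span (insert v V)"
proof -
  have "vec.span (insert v V) \<subseteq> W"
    using assms by (intro vec.span_minimal) (auto simp: level_def)
  moreover have "vec.dim (vec.span (insert v V)) = Suc d"
    using assms by (auto simp: level_def vec.dim_insert vec.span_eq_iff[THEN iffD2])
  ultimately show ?thesis
    using assms vec.subspace_dim_equal[of "vec.span (insert v V)" W] by (auto simp: level_def)
qed

lemma span_insert_level:
  fixes V :: "('a::field ^ 'n) set"
  assumes "V \<in> level d" "v \<notin> V"
  shows "vec.span (insert v V) \<in> level (Suc d)"
  using assms by (auto simp: level_def vec.dim_insert vec.span_eq_iff[THEN iffD2])

text \<open>The differences W - V have q^(d+1) - q^d vectors each and partition Y - V, which has q^m
  - q^d.\<close>

lemma card_upper_covers_within:
  fixes V Y :: "('a::{field,finite} ^ 'n) set"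
  assumes V: "V \<in> level d" and Y: "Y \<in> level m" and VY: "V \<subseteq> Y"
  shows "real (card {W \<in> level (Suc d). V \<subseteq> W \<and> W \<subseteq> Y}) = qnum CARD('a) (m - d)"
proof -
  let ?q = "CARD('a)"
  let ?\<W> = "{W \<in> level (Suc d). V \<subseteq> W \<and> W \<subseteq> Y}"
  have dm: "d \<le> m"
    using V Y VY vec.dim_subset[of V Y] by (auto simp: level_def)
  have un: "Y - V = (\<Union>W\<in>?\<W>. W - V)"
  proof (intro equalityI subsetI)
    fix v assume v: "v \<in> Y - V"
    have "vec.span (insert v V) \<subseteq> Y"
      using v VY Y by (intro vec.span_minimal) (auto simp: level_def)
    moreover have "V \<subseteq> vec.span (insert v V)" "v \<in> vec.span (insert v V)"
      by (auto intro: vec.span_base)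
    ultimately show "v \<in> (\<Union>W\<in>?\<W>. W - V)"
      using span_insert_level[OF V, of v] v by blast
  qed auto
  have "card (Y - V) = (\<Sum>W\<in>?\<W>. card (W - V))"
    unfolding un
  proof (rule card_UN_disjoint)
    show "\<forall>W\<in>?\<W>. \<forall>W'\<in>?\<W>. W \<noteq> W' \<longrightarrow> (W - V) \<inter> (W' - V) = {}"
    proof (intro ballI impI)
      fix W W' assume "W \<in> ?\<W>" "W' \<in> ?\<W>" "W \<noteq> W'"
      then have "v \<in> V" if "v \<in> W" "v \<in> W'" for v
        using level_unique_super[OF V, of W v] level_unique_super[OF V, of W' v] that
        by (metis (mono_tags, lifting) mem_Collect_eq)
      then show "(W - V) \<inter> (W' - V) = {}" by auto
    qed
  qed auto
  also have "\<dots> = (\<Sum>W\<in>?\<W>. ?q ^ Suc d - ?q ^ d)"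
    using V by (intro sum.cong) (auto simp: level_def card_Diff_subset card_subspace)
  also have "card (Y - V) = ?q ^ m - ?q ^ d"
    using V Y VY by (auto simp: level_def card_Diff_subset card_subspace)
  finally have "card ?\<W> * (?q ^ Suc d - ?q ^ d) = ?q ^ m - ?q ^ d" by simp
  then have "real (card ?\<W> * (?q ^ Suc d - ?q ^ d)) = real (?q ^ m - ?q ^ d)" by simp
  moreover have "?q ^ d \<le> ?q ^ Suc d" "?q ^ d \<le> ?q ^ m"
    using dm by (auto intro!: power_increasing)
  ultimately have "real (card ?\<W>) * (real ?q ^ Suc d - real ?q ^ d) = real ?q ^ m - real ?q ^ d"
    by (simp add: of_nat_diff)
  moreover have "real ?q ^ m = real ?q ^ d * real ?q ^ (m - d)"
    using dm by (simp flip: power_add)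
  ultimately have "real ?q ^ d * (real (card ?\<W>) * (real ?q - 1)) = real ?q ^ d * (qnum ?q (m - d) * (real ?q - 1))"
    unfolding qnum_mult_diff by (simp add: algebra_simps)
  then show ?thesis
    using card_field_ge_2[where 'a = 'a] by simp
qed

lemma UNIV_level: "(UNIV :: ('a::field ^ 'n) set) \<in> level CARD('n)"
  by (auto simp: level_def vec.dim_UNIV card_cart_basis)

lemma card_upper_covers:
  fixes V :: "('a::{field,finite} ^ 'n) set"
  assumes "V \<in> level d"
  shows "real (card {W \<in> level (Suc d). V \<subseteq> W}) = qnum CARD('a) (CARD('n) - d)"
  using card_upper_covers_within[OF assms UNIV_level] by simp

text \<open>By the dimension formula the intersection has dimension at least 2(d+1) - (d+2) = d, and
  less than d + 1 because \<open>V\<close> and \<open>V'\<close> differ.\<close>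

lemma Int_level:
  fixes V V' :: "('a::field ^ 'n) set"
  assumes "V \<in> level (Suc d)" "V' \<in> level (Suc d)" "V \<noteq> V'" "W \<in> level (Suc (Suc d))"
    and "V \<subseteq> W" "V' \<subseteq> W"
  shows "V \<inter> V' \<in> level d"
proof -
  have sub: "vec.subspace V" "vec.subspace V'" "vec.subspace W"
    and dim: "vec.dim V = Suc d" "vec.dim V' = Suc d" "vec.dim W = Suc (Suc d)"
    using assms by (auto simp: level_def)
  have "vec.dim {x + y |x y. x \<in> V \<and> y \<in> V'} \<le> vec.dim W"
    using assms sub by (intro vec.dim_subset) (auto intro: vec.subspace_add)
  then have "vec.dim (V \<inter> V') \<ge> d"
    using vec.dim_sums_Int[OF sub(1,2)] dim by simp
  moreover have "vec.dim (V \<inter> V') < Suc d"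
  proof (rule ccontr)
    assume "\<not> ?thesis"
    then have "V \<inter> V' = V" "V \<inter> V' = V'"
      using vec.subspace_dim_equal[of "V \<inter> V'"] sub dim by (auto simp: vec.subspace_inter)
    then show False using assms by auto
  qed
  ultimately show ?thesis
    using sub by (auto simp: level_def vec.subspace_inter)
qed

lemma span_Un_level:
  fixes V V' :: "('a::field ^ 'n) set"
  assumes "V \<in> level (Suc d)" "V' \<in> level (Suc d)" "V \<inter> V' \<in> level d"
  shows "vec.span (V \<union> V') \<in> level (Suc (Suc d))"
proof -
  have sub: "vec.subspace V" "vec.subspace V'"
    and dim: "vec.dim V = Suc d" "vec.dim V' = Suc d" "vec.dim (V \<inter> V') = d"
    using assms by (auto simp: level_def)
  have "vec.span (V \<union> V') = {x + y |x y. x \<in> V \<and> y \<in> V'}"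
    using sub by (simp add: vec.span_Un vec.span_eq_iff[THEN iffD2])
  then show ?thesis
    using vec.dim_sums_Int[OF sub] dim vec.subspace_span[of "V \<union> V'"]
    by (simp add: level_def del: vec.dim_span)
qed

lemma level_0: "level 0 = {{0 :: 'a::field ^ 'n}}"
  by (auto simp: level_def subset_singleton_iff dest: vec.subspace_0)

lemma level_eqI: "V \<in> level d \<Longrightarrow> W \<in> level d \<Longrightarrow> V \<subseteq> W \<Longrightarrow> V = W"
  for V :: "('a::field ^ 'n) set"
  using vec.subspace_dim_equal[of V W] by (auto simp: level_def)

lemma level_subset_exists:
  fixes W :: "('a::field ^ 'n) set"
  assumes "W \<in> level m" "d \<le> m"
  obtains V where "V \<in> level d" "V \<subseteq> W"
  using vec.choose_subspace_of_subspace[of d W] assms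
  by (auto simp: level_def vec.span_eq_iff[THEN iffD2])

text \<open>Fixing one hyperplane \<open>H\<close> of \<open>W\<close> avoids duality: every other
  hyperplane of \<open>W\<close> meets \<open>H\<close> in a hyperplane \<open>U\<close> of
  \<open>H\<close>, and each \<open>U\<close> accounts for q of them. This yields the recursion 1 +
  q [d+1] = [d+2].\<close>

lemma card_lower_covers:
  fixes W :: "('a::{field,finite} ^ 'n) set"
  assumes "W \<in> level (Suc d)"
  shows "real (card {V \<in> level d. V \<subseteq> W}) = qnum CARD('a) (Suc d)"
  using assms
proof (induction d arbitrary: W)
  case 0
  then have "{V \<in> level 0. V \<subseteq> W} = {{0}}"
    by (auto simp: level_0 level_def vec.subspace_0)
  then show ?case by simp
next
  case (Suc d)
  obtain H where H: "H \<in> level (Suc d)" "H \<subseteq> W"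
    using level_subset_exists[OF Suc.prems] by (metis le_SucI order_refl)
  let ?C = "\<lambda>U. {V \<in> level (Suc d). U \<subseteq> V \<and> V \<subseteq> W} - {H}"
  have un: "{V \<in> level (Suc d). V \<subseteq> W} = insert H (\<Union>U\<in>{U \<in> level d. U \<subseteq> H}. ?C U)"
  proof (intro equalityI subsetI)
    fix V assume V: "V \<in> {V \<in> level (Suc d). V \<subseteq> W}"
    show "V \<in> insert H (\<Union>U\<in>{U \<in> level d. U \<subseteq> H}. ?C U)"
    proof (cases "V = H")
      case False
      then have "V \<inter> H \<in> level d"
        using Int_level[of V d H W] V H Suc.prems by auto
      then show ?thesis using V False by auto
    qed simp
  qed (use H in auto)
  have "card (\<Union>U\<in>{U \<in> level d. U \<subseteq> H}. ?C U) = (\<Sum>U\<in>{U \<in> level d. U \<subseteq> H}. card (?C U))"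
  proof (rule card_UN_disjoint)
    have "U = V \<inter> H" if "U \<in> level d" "U \<subseteq> H" "V \<in> ?C U" for U V
      using that Int_level[of V d H W] H Suc.prems by (intro level_eqI[of U d]) auto
    then show "\<forall>U\<in>{U \<in> level d. U \<subseteq> H}. \<forall>U'\<in>{U \<in> level d. U \<subseteq> H}.
      U \<noteq> U' \<longrightarrow> ?C U \<inter> ?C U' = {}"
      by blast
  qed auto
  also have "real \<dots> = (\<Sum>U\<in>{U \<in> level d. U \<subseteq> H}. real CARD('a))"
    unfolding of_nat_sum
  proof (rule sum.cong)
    fix U assume U: "U \<in> {U \<in> level d. U \<subseteq> H}"
    \<comment> \<open>The quotient of \<open>W\<close> by \<open>U\<close> has dimension 2, hence
      [2] = q + 1 lines, one of which comes from \<open>H\<close>.\<close>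
    then have "real (card {V \<in> level (Suc d). U \<subseteq> V \<and> V \<subseteq> W}) = qnum CARD('a) 2"
      using card_upper_covers_within[of U d W "Suc (Suc d)"] Suc.prems H by (auto simp: numeral_2_eq_2)
    then have "real (card {V \<in> level (Suc d). U \<subseteq> V \<and> V \<subseteq> W}) = real (1 + CARD('a))"
      by (simp add: numeral_2_eq_2 qnum_Suc)
    then have "card {V \<in> level (Suc d). U \<subseteq> V \<and> V \<subseteq> W} = 1 + CARD('a)"
      by (simp only: of_nat_eq_iff)
    moreover have "H \<in> {V \<in> level (Suc d). U \<subseteq> V \<and> V \<subseteq> W}"
      using U H by auto
    ultimately show "real (card (?C U)) = real CARD('a)"
      by (simp add: card_Diff_singleton)
  qed simp
  also have "\<dots> = real CARD('a) * qnum CARD('a) (Suc d)"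
    using Suc.IH[OF H(1)] by simp
  finally show ?case
    unfolding un by (subst card_insert_disjoint) (auto simp: qnum_Suc[of _ "Suc d"])
qed

section \<open>The spectral gap of the Grassmann graph and upper shadows\<close>

text \<open>The squared norm of the image of \<open>f\<close> under the incidence operator of
  \<open>R\<close>, as a quadratic form whose matrix counts common neighbours.\<close>

lemma sum_square_relation:
  fixes f :: "'a \<Rightarrow> real"
  assumes "finite A" "finite B"
  shows "(\<Sum>b\<in>B. (\<Sum>a\<in>{a \<in> A. R a b}. f a)\<^sup>2)
    = (\<Sum>a\<in>A. \<Sum>a'\<in>A. f a * f a' * real (card {b \<in> B. R a b \<and> R a' b}))"
proof -
  have "(\<Sum>b\<in>B. (\<Sum>a\<in>{a \<in> A. R a b}. f a)\<^sup>2)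
      = (\<Sum>b\<in>B. \<Sum>a\<in>A. \<Sum>a'\<in>A. if R a b \<and> R a' b then f a * f a' else 0)"
    unfolding sum.inter_filter[OF assms(1)] power2_eq_square sum_product
    by (intro sum.cong refl) simp
  also have "\<dots> = (\<Sum>a\<in>A. \<Sum>a'\<in>A. \<Sum>b\<in>B. if R a b \<and> R a' b then f a * f a' else 0)"
    by (subst sum.swap, rule sum.cong[OF refl], rule sum.swap)
  also have "\<dots> = (\<Sum>a\<in>A. \<Sum>a'\<in>A. f a * f a' * real (card {b \<in> B. R a b \<and> R a' b}))"
    by (intro sum.cong refl) (simp add: assms flip: sum.inter_filter)
  finally show ?thesis .
qed

text \<open>If \<open>V\<close> and \<open>V'\<close> meet in dimension d, their sum and their
  intersection are the only candidates and both counts are 1; otherwise both are 0.\<close>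

lemma card_common_covers:
  fixes V V' :: "('a::{field,finite} ^ 'n) set"
  assumes V: "V \<in> level (Suc d)" "V' \<in> level (Suc d)" "V \<noteq> V'"
  shows "card {W \<in> level (Suc (Suc d)). V \<subseteq> W \<and> V' \<subseteq> W} = card {U \<in> level d. U \<subseteq> V \<and> U \<subseteq> V'}"
proof (cases "V \<inter> V' \<in> level d")
  case True
  have "W = vec.span (V \<union> V')" if "W \<in> level (Suc (Suc d))" "V \<subseteq> W" "V' \<subseteq> W" for W
  proof -
    have "vec.subspace W" using that(1) unfolding level_def by blast
    then have "vec.span (V \<union> V') \<subseteq> W" using that(2,3) by (intro vec.span_minimal Un_least)
    then show ?thesis using level_eqI[OF span_Un_level[OF V(1,2) True] that(1)] by metis
  qed
  moreover have "V \<subseteq> vec.span (V \<union> V')" "V' \<subseteq> vec.span (V \<union> V')"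
    using vec.span_superset[of "V \<union> V'"] by auto
  ultimately have "{W \<in> level (Suc (Suc d)). V \<subseteq> W \<and> V' \<subseteq> W} = {vec.span (V \<union> V')}"
    using span_Un_level[OF V(1,2) True] by blast
  moreover have "U = V \<inter> V'" if "U \<in> level d" "U \<subseteq> V" "U \<subseteq> V'" for U
    using that by (intro level_eqI[OF _ True]) auto
  then have "{U \<in> level d. U \<subseteq> V \<and> U \<subseteq> V'} = {V \<inter> V'}"
    using True by blast
  ultimately show ?thesis by simp
next
  case False
  then have "{W \<in> level (Suc (Suc d)). V \<subseteq> W \<and> V' \<subseteq> W} = {}"
    using Int_level[OF V] by auto
  moreover have "U \<subseteq> V \<inter> V' \<Longrightarrow> U \<in> level d \<Longrightarrow> V \<inter> V' \<in> level d" for U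
  proof -
    assume U: "U \<subseteq> V \<inter> V'" "U \<in> level d"
    have sub: "vec.subspace (V \<inter> V')"
      using V by (auto simp: level_def vec.subspace_inter)
    have "vec.dim (V \<inter> V') \<noteq> Suc d"
    proof
      assume "vec.dim (V \<inter> V') = Suc d"
      then have "V \<inter> V' \<in> level (Suc d)" using sub by (simp add: level_def)
      then have "V \<inter> V' = V" "V \<inter> V' = V'"
        using level_eqI[of "V \<inter> V'" "Suc d"] V by blast+
      then show False using V by auto
    qed
    moreover have "vec.dim (V \<inter> V') \<le> Suc d" "d \<le> vec.dim (V \<inter> V')"
      using U vec.dim_subset[of "V \<inter> V'" V] V vec.dim_subset[of U "V \<inter> V'"] by (auto simp: level_def)
    ultimately show ?thesis using sub by (auto simp: level_def)
  qed
  then have "{U \<in> level d. U \<subseteq> V \<and> U \<subseteq> V'} = {}"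
    using False by auto
  ultimately show ?thesis by (simp only:)
qed

text \<open>The commutation relation of the up and down operators, evaluated at \<open>f\<close>. By
  \<open>card_common_covers\<close> the two quadratic forms agree off the diagonal; on it stand
  [n-d-1] upper covers against [d+1] lower covers.\<close>

lemma up_down_identity:
  fixes f :: "('a::{field,finite} ^ 'n) set \<Rightarrow> real"
  defines "n \<equiv> CARD('n)" and "q \<equiv> CARD('a)"
  shows "(\<Sum>W\<in>level (Suc (Suc d)). (\<Sum>V\<in>{V \<in> level (Suc d). V \<subseteq> W}. f V)\<^sup>2)
    = (\<Sum>U\<in>level d. (\<Sum>V\<in>{V \<in> level (Suc d). U \<subseteq> V}. f V)\<^sup>2)
      + (qnum q (n - Suc d) - qnum q (Suc d)) * (\<Sum>V\<in>level (Suc d). (f V)\<^sup>2)"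
proof -
  let ?L = "level (Suc d) :: ('a ^ 'n) set set"
  have diff: "f V * f V' * real (card {W \<in> level (Suc (Suc d)). V \<subseteq> W \<and> V' \<subseteq> W})
      = f V * f V' * real (card {U \<in> level d. U \<subseteq> V \<and> U \<subseteq> V'})
        + (if V = V' then (qnum q (n - Suc d) - qnum q (Suc d)) * (f V)\<^sup>2 else 0)"
    if "V \<in> ?L" "V' \<in> ?L" for V V'
  proof (cases "V = V'")
    case True
    then show ?thesis
      using card_upper_covers[OF that(1)] card_lower_covers[OF that(1)]
      by (simp add: n_def q_def algebra_simps power2_eq_square)
  next
    case False
    then show ?thesis using card_common_covers[OF that] by simp
  qed
  have "(\<Sum>W\<in>level (Suc (Suc d)). (\<Sum>V\<in>{V \<in> ?L. V \<subseteq> W}. f V)\<^sup>2)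
      = (\<Sum>V\<in>?L. \<Sum>V'\<in>?L. f V * f V' * real (card {U \<in> level d. U \<subseteq> V \<and> U \<subseteq> V'})
        + (if V = V' then (qnum q (n - Suc d) - qnum q (Suc d)) * (f V)\<^sup>2 else 0))"
    by (subst sum_square_relation) (auto simp: diff intro!: sum.cong)
  also have "\<dots> = (\<Sum>U\<in>level d. (\<Sum>V\<in>{V \<in> ?L. U \<subseteq> V}. f V)\<^sup>2)
      + (\<Sum>V\<in>?L. (qnum q (n - Suc d) - qnum q (Suc d)) * (f V)\<^sup>2)"
    by (subst sum_square_relation) (simp_all add: sum.distrib sum.delta)
  finally show ?thesis by (simp add: sum_distrib_left)
qed

text \<open>This is how the factor in \<open>spectral_gap\<close> passes from d to d + 1 when the
  diagonal term of \<open>up_down_identity\<close> is added.\<close>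

lemma qnum_gap_step:
  assumes "Suc d < n"
  shows "real q * qnum q d * qnum q (n - Suc d) + (qnum q (n - Suc d) - qnum q (Suc d))
    = real q * qnum q (Suc d) * qnum q (n - Suc (Suc d))"
proof -
  obtain m where "n = Suc (Suc d) + m"
    using assms by (metis Suc_leI le_iff_add)
  then show ?thesis
    by (simp add: Suc_diff_le qnum_Suc) (simp add: algebra_simps)
qed

text \<open>Sum zero excludes the constants, for which the factor is [d+1] [n-d]. In the induction
  step the down image \<open>g\<close> of \<open>f\<close> has sum zero again, so the hypothesis
  bounds the up image of \<open>g\<close>. Up and down being adjoint, Cauchy-Schwarz turns this into
  a bound for \<open>g\<close> itself, and \<open>up_down_identity\<close> leads to the up image of
  \<open>f\<close>.\<close>

lemma spectral_gap:
  fixes f :: "('a::{field,finite} ^ 'n) set \<Rightarrow> real"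
  defines "n \<equiv> CARD('n)" and "q \<equiv> CARD('a)"
  assumes "d < n" and "(\<Sum>V\<in>level d. f V) = 0"
  shows "(\<Sum>W\<in>level (Suc d). (\<Sum>V\<in>{V \<in> level d. V \<subseteq> W}. f V)\<^sup>2)
    \<le> real q * qnum q d * qnum q (n - Suc d) * (\<Sum>V\<in>level d. (f V)\<^sup>2)"
  using assms(3,4)
proof (induction d arbitrary: f)
  case 0
  then have "f {0} = 0" by (simp add: level_0)
  then have "f V = 0" if "V \<in> level 0" for V
    using that by (simp add: level_0)
  then show ?case by simp
next
  case (Suc d)
  let ?L = "level (Suc d) :: ('a ^ 'n) set set"
  define lam where "lam = real q * qnum q d * qnum q (n - Suc d)"
  define g where "g U = (\<Sum>V\<in>{V \<in> ?L. U \<subseteq> V}. f V)" for U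
  define G where "G = (\<Sum>U\<in>level d. (g U)\<^sup>2)"
  define S where "S = (\<Sum>V\<in>?L. (f V)\<^sup>2)"
  have "lam \<ge> 0" "S \<ge> 0" "G \<ge> 0"
    by (auto simp: lam_def S_def G_def intro!: sum_nonneg)
  \<comment> \<open>Each \<open>V\<close> is counted once for each of its [d+1] lower
    covers.\<close>
  have "(\<Sum>U\<in>level d. g U) = (\<Sum>V\<in>?L. \<Sum>U\<in>{U \<in> level d. U \<subseteq> V}. f V)"
    unfolding g_def by (rule sum.swap_restrict) auto
  also have "\<dots> = (\<Sum>V\<in>?L. qnum q (Suc d) * f V)"
    unfolding q_def by (intro sum.cong refl) (simp flip: card_lower_covers)
  also have "\<dots> = 0"
    using Suc.prems by (simp flip: sum_distrib_left)
  finally have "(\<Sum>V\<in>?L. (\<Sum>U\<in>{U \<in> level d. U \<subseteq> V}. g U)\<^sup>2) \<le> lam * G"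
    using Suc.IH[of g] Suc.prems by (simp add: lam_def G_def)
  \<comment> \<open>Adjointness: the squared norm of \<open>g\<close> is the inner product of
    \<open>f\<close> with the up image of \<open>g\<close>.\<close>
  moreover have "G = (\<Sum>U\<in>level d. \<Sum>V\<in>{V \<in> ?L. U \<subseteq> V}. f V * g U)"
    unfolding G_def power2_eq_square by (intro sum.cong refl) (simp add: g_def sum_distrib_right)
  then have "G = (\<Sum>V\<in>?L. \<Sum>U\<in>{U \<in> level d. U \<subseteq> V}. f V * g U)"
    by (subst sum.swap_restrict) auto
  then have "G = (\<Sum>V\<in>?L. f V * (\<Sum>U\<in>{U \<in> level d. U \<subseteq> V}. g U))"
    by (simp add: sum_distrib_left)
  then have "G\<^sup>2 \<le> S * (\<Sum>V\<in>?L. (\<Sum>U\<in>{U \<in> level d. U \<subseteq> V}. g U)\<^sup>2)"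
    unfolding S_def by (simp only: Cauchy_Schwarz_ineq_sum)
  ultimately have "G\<^sup>2 \<le> S * (lam * G)"
    using \<open>S \<ge> 0\<close> by (meson mult_left_mono order_trans)
  then have "G * G \<le> (lam * S) * G"
    by (simp add: power2_eq_square algebra_simps)
  \<comment> \<open>One factor \<open>G\<close> cancels; if \<open>G\<close> is 0, the right side is
    nonnegative anyway.\<close>
  then have "G \<le> lam * S"
    using \<open>G \<ge> 0\<close> \<open>lam \<ge> 0\<close> \<open>S \<ge> 0\<close> by (cases "G = 0") auto
  then have "G + (qnum q (n - Suc d) - qnum q (Suc d)) * S
      \<le> (lam + (qnum q (n - Suc d) - qnum q (Suc d))) * S"
    by (simp add: algebra_simps)
  also have "\<dots> = real q * qnum q (Suc d) * qnum q (n - Suc (Suc d)) * S"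
    using qnum_gap_step[OF Suc.prems(1)] by (simp add: lam_def)
  finally show ?case
    using up_down_identity[of f d] by (simp add: G_def S_def g_def n_def q_def)
qed

lemma level_nonempty:
  assumes "d \<le> CARD('n)"
  shows "(level d :: ('a::field ^ 'n) set set) \<noteq> {}"
  using level_subset_exists[OF UNIV_level assms] by blast

lemma card_level_pos:
  assumes "d \<le> CARD('n)"
  shows "card (level d :: ('a::{field,finite} ^ 'n) set set) > 0"
  using level_nonempty[OF assms] by (simp add: card_gt_0_iff)

text \<open>Double counting of the incident pairs in dimensions d and d + 1.\<close>

lemma card_level_Suc:
  fixes q n :: nat
  defines "L \<equiv> (level :: nat \<Rightarrow> ('a::{field,finite} ^ 'n) set set)"
  defines "n \<equiv> CARD('n)" and "q \<equiv> CARD('a)"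
  shows "real (card (L (Suc d))) * qnum q (Suc d) = real (card (L d)) * qnum q (n - d)"
proof -
  have "(\<Sum>V\<in>L d. \<Sum>W\<in>{W \<in> L (Suc d). V \<subseteq> W}. 1 :: real)
      = (\<Sum>W\<in>L (Suc d). \<Sum>V\<in>{V \<in> L d. V \<subseteq> W}. 1)"
    by (rule sum.swap_restrict) auto
  then show ?thesis
    by (simp add: L_def n_def q_def card_upper_covers card_lower_covers)
qed

section \<open>Upper shadows and their densities\<close>

definition up_level :: "nat \<Rightarrow> ('a::field ^ 'n) set set \<Rightarrow> ('a ^ 'n) set set" where
  "up_level i \<F> = {W \<in> level i. \<exists>V\<in>\<F>. V \<subseteq> W}"

definition density :: "nat \<Rightarrow> ('a::field ^ 'n) set set \<Rightarrow> real" where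
  "density d \<F> = real (card \<F>) / real (card (level d :: ('a ^ 'n) set set))"

text \<open>Let u(W) be the number of members below \<open>W\<close>. Cauchy-Schwarz over the
  shadow, which supports u, compares the square of [n-d] |F| with the shadow size times the sum of
  the u(W)^2. That sum is bounded by splitting the indicator of the family into its mean
  \<open>\<mu>\<close> and a part of sum zero, to which \<open>spectral_gap\<close> applies.\<close>

lemma shadow_bound:
  fixes \<F> :: "('a::{field,finite} ^ 'n) set set" and d :: nat
  defines "n \<equiv> CARD('n)" and "q \<equiv> CARD('a)" and "\<mu> \<equiv> density d \<F>"
  assumes "d < n" and F: "\<F> \<subseteq> level d"
  shows "real (card \<F>) * (qnum q (n - d))\<^sup>2 \<le> real (card (up_level (Suc d) \<F>)) *
    (\<mu> * (qnum q (Suc d) * qnum q (n - d)) + (1 - \<mu>) * (real q * qnum q d * qnum q (n - Suc d)))"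
proof (cases "\<F> = {}")
  case False
  let ?L = "level d :: ('a ^ 'n) set set" and ?M = "level (Suc d) :: ('a ^ 'n) set set"
  let ?S = "up_level (Suc d) \<F>"
  let ?b = "qnum q (Suc d)" and ?c = "qnum q (n - d)"
  let ?l = "real q * qnum q d * qnum q (n - Suc d)"
  define f :: "('a ^ 'n) set \<Rightarrow> real" where "f = indicator \<F>"
  define u where "u W = (\<Sum>V\<in>{V \<in> ?L. V \<subseteq> W}. f V)" for W
  have pos: "real (card ?L) > 0"
    using card_level_pos[of d, where 'a = 'a and 'n = 'n] \<open>d < n\<close> by (auto simp: n_def)
  then have \<mu>: "real (card ?L) * \<mu> = real (card \<F>)"
    using F by (auto simp: \<mu>_def density_def)
  have sum_f: "(\<Sum>V\<in>?L. f V) = real (card \<F>)"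
    using F by (simp add: f_def indicator_def Int_absorb1 sum.If_cases)
  have sum_f2: "(\<Sum>V\<in>?L. (f V)\<^sup>2) = real (card \<F>)"
    using sum_f by (simp add: f_def indicator_def power2_eq_square if_distrib cong: if_cong)
  have sum_u: "(\<Sum>W\<in>?M. u W) = ?c * real (card \<F>)"
  proof -
    have "(\<Sum>W\<in>?M. u W) = (\<Sum>V\<in>?L. \<Sum>W\<in>{W \<in> ?M. V \<subseteq> W}. f V)"
      unfolding u_def by (rule sum.swap_restrict[symmetric]) auto
    also have "\<dots> = (\<Sum>V\<in>?L. ?c * f V)"
      unfolding q_def n_def by (intro sum.cong refl) (simp flip: card_upper_covers)
    finally show ?thesis by (simp add: sum_f flip: sum_distrib_left)
  qed
  \<comment> \<open>The up image of the constant \<open>\<mu>\<close> is \<open>\<mu>\<close> times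
    [d+1].\<close>
  have u0: "(\<Sum>V\<in>{V \<in> ?L. V \<subseteq> W}. f V - \<mu>) = u W - \<mu> * ?b" if "W \<in> ?M" for W
    using card_lower_covers[OF that] by (simp add: u_def sum_subtractf q_def mult.commute)
  have "(\<Sum>V\<in>?L. f V - \<mu>) = 0"
    using \<mu> by (simp add: sum_subtractf sum_f)
  from spectral_gap[OF _ this] \<open>d < n\<close>
  have "(\<Sum>W\<in>?M. (u W - \<mu> * ?b)\<^sup>2) \<le> ?l * (\<Sum>V\<in>?L. (f V - \<mu>)\<^sup>2)"
    by (simp add: n_def q_def u0 cong: sum.cong)
  moreover have "(\<Sum>V\<in>?L. (f V - \<mu>)\<^sup>2) = real (card \<F>) * (1 - \<mu>)"
  proof -
    have eq: "(\<Sum>V\<in>?L. (f V - \<mu>)\<^sup>2) = (\<Sum>V\<in>?L. (f V)\<^sup>2) - 2 * \<mu> * (\<Sum>V\<in>?L. f V) + real (card ?L) * \<mu>\<^sup>2"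
      by (simp add: power2_diff sum.distrib sum_subtractf sum_distrib_left sum_distrib_right algebra_simps)
    have "real (card ?L) * \<mu>\<^sup>2 = real (card \<F>) * \<mu>"
      by (simp add: power2_eq_square flip: \<mu>)
    then show ?thesis
      unfolding eq sum_f sum_f2 by (simp add: algebra_simps)
  qed
  \<comment> \<open>The cross term is twice the constant term, by \<open>card_level_Suc\<close>, so
    one copy of it survives with a minus sign.\<close>
  moreover have "(\<Sum>W\<in>?M. (u W - \<mu> * ?b)\<^sup>2) = (\<Sum>W\<in>?M. (u W)\<^sup>2) - real (card \<F>) * \<mu> * (?b * ?c)"
  proof -
    have "(\<Sum>W\<in>?M. (u W - \<mu> * ?b)\<^sup>2)
        = (\<Sum>W\<in>?M. (u W)\<^sup>2) - 2 * \<mu> * ?b * (\<Sum>W\<in>?M. u W) + \<mu>\<^sup>2 * ?b * (real (card ?M) * ?b)"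
      by (simp add: power2_diff sum.distrib sum_subtractf sum_distrib_left sum_distrib_right
          power_mult_distrib power2_eq_square algebra_simps)
    also have "real (card ?M) * ?b = real (card ?L) * ?c"
      unfolding q_def n_def by (rule card_level_Suc)
    also have "\<mu>\<^sup>2 * ?b * (real (card ?L) * ?c) = \<mu> * ?b * ((real (card ?L) * \<mu>) * ?c)"
      by (simp add: power2_eq_square)
    finally show ?thesis
      unfolding \<mu> sum_u by (simp add: algebra_simps)
  qed
  ultimately have norm_u: "(\<Sum>W\<in>?M. (u W)\<^sup>2) \<le> real (card \<F>) * (\<mu> * (?b * ?c) + (1 - \<mu>) * ?l)"
    by (simp add: algebra_simps)
  have "u W = 0" if "W \<in> ?M - ?S" for W
    using that by (auto simp: u_def f_def up_level_def indicator_def)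
  then have "(\<Sum>W\<in>?S. g (u W)) = (\<Sum>W\<in>?M. g (u W))" if "g 0 = 0" for g :: "real \<Rightarrow> real"
    using that by (intro sum.mono_neutral_left) (auto simp: up_level_def)
  from this[of "\<lambda>x. x"] this[of "\<lambda>x. x\<^sup>2"]
  have "?c * real (card \<F>) = (\<Sum>W\<in>?S. 1 * u W)" "(\<Sum>W\<in>?S. (u W)\<^sup>2) = (\<Sum>W\<in>?M. (u W)\<^sup>2)"
    by (simp_all add: sum_u)
  then have "(?c * real (card \<F>))\<^sup>2 \<le> (\<Sum>W\<in>?S. 1\<^sup>2) * (\<Sum>W\<in>?M. (u W)\<^sup>2)"
    using Cauchy_Schwarz_ineq_sum[of "\<lambda>_. 1" u ?S] by simp
  also have "\<dots> \<le> real (card ?S) * (real (card \<F>) * (\<mu> * (?b * ?c) + (1 - \<mu>) * ?l))"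
    using norm_u by (simp add: mult_left_mono)
  finally have "real (card \<F>) * (real (card \<F>) * ?c\<^sup>2)
      \<le> real (card \<F>) * (real (card ?S) * (\<mu> * (?b * ?c) + (1 - \<mu>) * ?l))"
    by (simp add: power2_eq_square algebra_simps)
  moreover have "real (card \<F>) > 0"
    using False by (simp add: card_gt_0_iff)
  ultimately show ?thesis by simp
qed (simp add: up_level_def)

text \<open>\<open>shadow_bound\<close> normalised by the sizes of the levels d + 1 and d, whose
  ratio is [n-d] / [d+1].\<close>

lemma density_up_level:
  fixes \<F> :: "('a::{field,finite} ^ 'n) set set" and d :: nat
  defines "n \<equiv> CARD('n)" and "q \<equiv> CARD('a)" and "\<mu> \<equiv> density d \<F>"
  assumes d: "d < n" and F: "\<F> \<subseteq> level d"
  shows "\<mu> * (qnum q (Suc d) * qnum q (n - d)) \<le> density (Suc d) (up_level (Suc d) \<F>) *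
    (\<mu> * (qnum q (Suc d) * qnum q (n - d)) + (1 - \<mu>) * (real q * qnum q d * qnum q (n - Suc d)))"
    (is "_ \<le> density _ ?S * ?g")
proof -
  let ?N = "\<lambda>i. real (card (level i :: ('a ^ 'n) set set))"
  let ?b = "qnum q (Suc d)" and ?c = "qnum q (n - d)"
  have N: "?N d > 0" "?N (Suc d) > 0"
    using card_level_pos[of d, where 'a = 'a and 'n = 'n]
      card_level_pos[of "Suc d", where 'a = 'a and 'n = 'n] d by (auto simp: n_def)
  have bc: "?b > 0" "?c > 0" using d by (auto intro!: qnum_pos)
  have NS: "?N (Suc d) * ?b = ?N d * ?c"
    unfolding n_def q_def by (rule card_level_Suc)
  have "?N d * \<mu> * ?c\<^sup>2 \<le> ?N (Suc d) * density (Suc d) ?S * ?g"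
  proof -
    have "real (card \<F>) = ?N d * \<mu>" "real (card ?S) = ?N (Suc d) * density (Suc d) ?S"
      using N by (simp_all add: \<mu>_def density_def del: card_0_eq)
    then show ?thesis
      using shadow_bound[of d \<F>] d F unfolding n_def q_def \<mu>_def by simp
  qed
  then have "?b * (?N d * \<mu> * ?c\<^sup>2) \<le> ?b * (?N (Suc d) * density (Suc d) ?S * ?g)"
    using bc by (intro mult_left_mono) auto
  also have "\<dots> = (?N (Suc d) * ?b) * density (Suc d) ?S * ?g" by (simp add: mult_ac)
  also have "\<dots> = ?N d * ?c * (density (Suc d) ?S * ?g)" unfolding NS by simp
  also have "?b * (?N d * \<mu> * ?c\<^sup>2) = ?N d * ?c * (\<mu> * (?b * ?c))"
    by (simp add: power2_eq_square mult_ac)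
  finally show ?thesis
    using N bc by (simp add: mult_ac)
qed

lemma density_nonneg: "density d \<F> \<ge> 0"
  by (simp add: density_def)

text \<open>For the d-subspaces through a fixed point, of density [d]/[n], the factor on the right
  of \<open>density_up_level\<close> is [d] [n-d]; the identity is multiplied by [n].\<close>

lemma shadow_bound_value_at_star:
  assumes "d < n"
  shows "qnum q d * (qnum q (Suc d) * qnum q (n - d))
      + (qnum q n - qnum q d) * (real q * qnum q d * qnum q (n - Suc d))
    = qnum q d * qnum q (n - d) * qnum q n"
proof -
  obtain m where n: "n = Suc d + m"
    using assms by (metis Suc_leI le_iff_add)
  then have diff: "n - d = Suc m" "n - Suc d = m" by auto
  have 1: "qnum q n - qnum q d = real q ^ d * qnum q (Suc m)"
    using qnum_add[of q d "Suc m"] by (simp add: n)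
  have 2: "qnum q n = qnum q (Suc d) + real q ^ d * (real q * qnum q m)"
    using qnum_add[of q "Suc d" m] by (simp add: n mult_ac)
  show ?thesis
    unfolding 1 unfolding 2 diff by (simp only: algebra_simps)
qed

lemma qnum_mono: "a \<le> b \<Longrightarrow> qnum q a \<le> qnum q b"
  using qnum_add[of q a "b - a"] by simp

text \<open>The factor on the right of \<open>density_up_level\<close> is affine in the density with
  nonnegative slope, so up to density [d]/[n] it is at most its value [d] [n-d] there.\<close>

lemma density_up_level_le:
  fixes \<F> :: "('a::{field,finite} ^ 'n) set set" and d :: nat
  defines "n \<equiv> CARD('n)" and "q \<equiv> CARD('a)"
  assumes d: "0 < d" "d < n" and F: "\<F> \<subseteq> level d" and le: "density d \<F> \<le> qnum q d / qnum q n"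
  shows "density d \<F> / qnum q d \<le> density (Suc d) (up_level (Suc d) \<F>) / qnum q (Suc d)"
proof -
  let ?m = "density d \<F>" and ?m' = "density (Suc d) (up_level (Suc d) \<F>)"
  let ?b = "qnum q (Suc d)" and ?c = "qnum q (n - d)" and ?a = "qnum q d"
  let ?e = "real q * ?a * qnum q (n - Suc d)"
  have pos: "?b > 0" "?c > 0" "?a > 0" "qnum q n > 0"
    using d by (auto intro!: qnum_pos)
  have "?e \<le> ?b * ?c"
  proof -
    have "real q * ?a \<le> ?b" by (simp add: qnum_Suc)
    then show ?thesis using d by (intro mult_mono qnum_mono) auto
  qed
  then have "?m * (?b * ?c) + (1 - ?m) * ?e
      \<le> ?a / qnum q n * (?b * ?c) + (1 - ?a / qnum q n) * ?e"
    using mult_right_mono[OF le, of "?b * ?c - ?e"] by (simp add: algebra_simps)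
  also have "\<dots> = (?a * (?b * ?c) + (qnum q n - ?a) * ?e) / qnum q n"
    using pos by (simp add: field_simps)
  also have "\<dots> = ?a * ?c"
    using pos by (simp add: shadow_bound_value_at_star[OF d(2)])
  finally have "?m' * (?m * (?b * ?c) + (1 - ?m) * ?e) \<le> ?m' * (?a * ?c)"
    by (intro mult_left_mono density_nonneg)
  then have "?m * (?b * ?c) \<le> ?m' * (?a * ?c)"
    using density_up_level[of d \<F>] d F by (simp add: n_def q_def)
  then have "(?m * ?b) * ?c \<le> (?m' * ?a) * ?c" by (simp add: mult_ac)
  then have "?m * ?b \<le> ?m' * ?a" using pos by simp
  then show ?thesis using pos by (simp add: field_simps)
qed

text \<open>The lower bound that \<open>density_up_level\<close> gives for the shadow is strictly
  increasing in the density and equals [d+1]/[n] at [d]/[n]. Strictness comes from \<open>e\<close>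
  > 0, where d + 1 < n enters.\<close>

lemma density_up_level_greater:
  fixes \<F> :: "('a::{field,finite} ^ 'n) set set" and d :: nat
  defines "n \<equiv> CARD('n)" and "q \<equiv> CARD('a)"
  assumes d: "0 < d" "Suc d < n" and F: "\<F> \<subseteq> level d" and gr: "density d \<F> > qnum q d / qnum q n"
  shows "density (Suc d) (up_level (Suc d) \<F>) > qnum q (Suc d) / qnum q n"
proof -
  let ?m = "density d \<F>" and ?m' = "density (Suc d) (up_level (Suc d) \<F>)"
  let ?b = "qnum q (Suc d)" and ?c = "qnum q (n - d)" and ?a = "qnum q d"
  define x where "x = ?a / qnum q n"
  define e where "e = real q * ?a * qnum q (n - Suc d)"
  have q0: "real q > 0" using card_field_ge_2[where 'a = 'a] by (simp add: q_def)
  have pos: "?b > 0" "?c > 0" "?a > 0" "qnum q n > 0"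
    using d by (auto intro!: qnum_pos)
  have e0: "e > 0" unfolding e_def using d pos q0 by (intro mult_pos_pos qnum_pos) auto
  have eb: "e \<le> ?b * ?c"
  proof -
    have "real q * ?a \<le> ?b" by (simp add: qnum_Suc)
    then show ?thesis unfolding e_def using d by (intro mult_mono qnum_mono) auto
  qed
  have x: "x > 0" "x < ?m" using pos gr by (auto simp: x_def)
  have "x * (?b * ?c) + (1 - x) * e = (?a * (?b * ?c) + (qnum q n - ?a) * e) / qnum q n"
    using pos by (simp add: field_simps x_def)
  also have "\<dots> = ?a * ?c"
    using pos d by (simp add: shadow_bound_value_at_star e_def)
  finally have gx: "x * (?b * ?c) + (1 - x) * e = ?a * ?c" .
  let ?g = "?m * (?b * ?c) + (1 - ?m) * e"
  have g: "?g = e + ?m * (?b * ?c - e)" by (simp add: algebra_simps)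
  have g0: "?g > 0" unfolding g using e0 eb x by (intro add_pos_nonneg) auto
  \<comment> \<open>Monotonicity of the quotient in cross-multiplied form: the two products differ
    by the positive number \<open>(?m - x) * e\<close>.\<close>
  have "?m * (?a * ?c) = x * ?g + (?m - x) * e"
    unfolding gx[symmetric] by (simp add: algebra_simps)
  then have "x * ?g < ?m * (?a * ?c)" using x e0 by simp
  then have "?b * (x * ?g) < ?b * (?m * (?a * ?c))" using pos by simp
  also have "\<dots> = ?a * (?m * (?b * ?c))" by simp
  also have "\<dots> \<le> ?a * (?m' * ?g)"
    using density_up_level[of d \<F>] d F pos by (simp add: n_def q_def e_def)
  finally have "(?a * (?b / qnum q n)) * ?g < (?a * ?m') * ?g" by (simp add: x_def mult_ac)
  then have "?a * (?b / qnum q n) < ?a * ?m'"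
    by (rule mult_right_less_imp_less) (use g0 in simp)
  then show ?thesis
    by (rule mult_left_less_imp_less) (use pos in simp)
qed

lemma density_mono:
  fixes \<F> \<G> :: "('a::{field,finite} ^ 'n) set set"
  assumes "\<F> \<subseteq> \<G>"
  shows "density d \<F> \<le> density d \<G>"
  using assms by (auto simp: density_def intro!: divide_right_mono card_mono)

text \<open>Iteration of \<open>density_up_level_greater\<close>; a shadow of a shadow lies in the
  direct shadow.\<close>

lemma up_level_greater:
  fixes \<F> :: "('a::{field,finite} ^ 'n) set set" and d m :: nat
  defines "n \<equiv> CARD('n)" and "q \<equiv> CARD('a)"
  assumes d: "0 < d" "d \<le> m" "m < n" and F: "\<F> \<subseteq> level d" and gr: "density d \<F> > qnum q d / qnum q n"
  shows "density m (up_level m \<F>) > qnum q m / qnum q n"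
  using d(2,3)
proof (induction m rule: dec_induct)
  case base
  have "\<F> \<subseteq> up_level d \<F>" using F by (auto simp: up_level_def)
  then show ?case using density_mono[of \<F> "up_level d \<F>" d] gr by simp
next
  case (step m)
  have "up_level m \<F> \<subseteq> level m" by (auto simp: up_level_def)
  then have "density (Suc m) (up_level (Suc m) (up_level m \<F>)) > qnum q (Suc m) / qnum q n"
    using density_up_level_greater[of m "up_level m \<F>"] step d by (simp add: n_def q_def)
  moreover have "up_level (Suc m) (up_level m \<F>) \<subseteq> up_level (Suc m) \<F>"
    by (auto simp: up_level_def)
  ultimately show ?case
    using density_mono by (metis less_le_trans)
qed

section \<open>Finite subfields of the algebraic closure and partial spreads\<close>

text \<open>Multiplication by a nonzero element permutes the nonzero elements, hence preserves their
  product.\<close>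

lemma finite_field_power_card: "(a :: 'a::{field,finite}) ^ CARD('a) = a"
proof (cases "a = 0")
  case False
  have "bij_betw ((*) a) (UNIV - {0}) (UNIV - {0 :: 'a})"
    using False by (intro bij_betwI[of _ _ _ "\<lambda>x. x / a"]) auto
  then have "(\<Prod>x\<in>UNIV - {0 :: 'a}. x) = (\<Prod>x\<in>UNIV - {0}. a * x)"
    by (rule prod.reindex_bij_betw[symmetric])
  also have "\<dots> = a ^ (CARD('a) - 1) * (\<Prod>x\<in>UNIV - {0}. x)"
    by (simp add: prod.distrib card_Diff_singleton)
  finally have "a ^ (CARD('a) - 1) = 1"
    by (simp add: prod_zero_iff)
  moreover have "CARD('a) = Suc (CARD('a) - 1)" by simp
  ultimately show ?thesis by (metis mult.right_neutral power_Suc)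
qed simp

text \<open>Translation by 1 permutes the field, so adding 1 to every element leaves the sum of all
  elements unchanged.\<close>

lemma of_nat_card_eq_0: "of_nat CARD('a) = (0 :: 'a::{field,finite})"
proof -
  have "bij_betw (\<lambda>x. x + 1) UNIV (UNIV :: 'a set)"
    by (intro bij_betwI[of _ _ _ "\<lambda>x. x - 1"]) auto
  then have "(\<Sum>x\<in>(UNIV :: 'a set). x) = (\<Sum>x\<in>(UNIV :: 'a set). x + 1)"
    by (rule sum.reindex_bij_betw[symmetric])
  then show ?thesis by (simp add: sum.distrib)
qed

text \<open>The argument avoids knowing that the cardinality is a power of the characteristic:
  \<open>z ^ q - z\<close> is the product of the \<open>z - c\<close> over the field elements \<open>c\<close>, hence invariant
  under translation by the field; so \<open>(z + y) ^ q - z ^ q - y ^ q\<close>, of degree below \<open>q\<close> in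
  \<open>z\<close>, vanishes at the \<open>q\<close> field elements.\<close>
lemma power_card_add:
  fixes x y :: "'a::{field,finite} alg_closure"
  defines "q \<equiv> CARD('a)"
  shows "(x + y) ^ q = x ^ q + y ^ q"
proof -
  have q2: "q \<ge> 2" using card_field_ge_2[where 'a = 'a] by (simp add: q_def)
  define F :: "'a alg_closure set" where "F = range to_ac"
  have F: "finite F" "card F = q"
    by (auto simp: F_def q_def card_image inj_to_ac)
  have Fq: "c ^ q = c" if "c \<in> F" for c
    using that by (auto simp: F_def q_def finite_field_power_card simp flip: to_ac_power)
  have lin: "Polynomial.degree [:a, 1 :: 'a alg_closure:] = 1" for a by simp
  have "Polynomial.monom 1 q - [:0, 1:] = (\<Prod>c\<in>F. [:-c, 1:])"
  proof (rule poly_eqI_degree_lead_coeff[where n = q and A = F])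
    have deg: "Polynomial.degree (\<Prod>c\<in>F. [:-c, 1:]) = q"
      by (subst degree_prod_eq_sum_degree) (auto simp: F)
    then show "Polynomial.degree (\<Prod>c\<in>F. [:-c, 1:]) \<le> q" by simp
    have "Polynomial.lead_coeff (\<Prod>c\<in>F. [:-c, 1:]) = 1"
      by (simp add: lead_coeff_prod)
    then show "Polynomial.coeff (Polynomial.monom 1 q - [:0, 1:]) q = Polynomial.coeff (\<Prod>c\<in>F. [:-c, 1:]) q"
      using deg q2 by (simp add: coeff_pCons split: nat.splits)
    show "Polynomial.degree (Polynomial.monom 1 q - [:0, 1 :: 'a alg_closure:]) \<le> q"
      using q2 by (intro degree_diff_le) (auto simp: degree_monom_le)
    show "poly (Polynomial.monom 1 q - [:0, 1:]) c = poly (\<Prod>c\<in>F. [:-c, 1:]) c" if "c \<in> F" for c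
      using that F Fq by (auto simp: poly_monom poly_prod prod_zero_iff)
  qed (simp_all add: F)
  from arg_cong[OF this, of "\<lambda>p. poly p z" for z]
  have prod: "z ^ q - z = (\<Prod>c\<in>F. z - c)" for z
    by (simp add: poly_monom poly_prod)
  have translate: "(c + y) ^ q = c ^ q + y ^ q" if c: "c \<in> F" for c
  proof -
    obtain c0 where c0: "c = to_ac c0" using c unfolding F_def by blast
    have "bij_betw (\<lambda>d. d + c) F F"
      unfolding F_def c0
    proof (rule bij_betwI[of _ _ _ "\<lambda>d. d - to_ac c0"])
      show "(\<lambda>d. d + to_ac c0) \<in> range to_ac \<rightarrow> range to_ac"
        by (auto simp flip: to_ac_add)
      show "(\<lambda>d. d - to_ac c0) \<in> range to_ac \<rightarrow> range to_ac"
        by (auto simp flip: to_ac_diff)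
    qed auto
    then have "(\<Prod>d\<in>F. (c + y) - d) = (\<Prod>d\<in>F. (c + y) - (d + c))"
      by (rule prod.reindex_bij_betw[symmetric])
    also have "\<dots> = (\<Prod>d\<in>F. y - d)" by (simp add: algebra_simps)
    finally have "(c + y) ^ q - (c + y) = y ^ q - y" by (simp only: prod)
    then show ?thesis using Fq[OF c] by (simp add: algebra_simps)
  qed
  have "[:y, 1:] ^ q = Polynomial.monom 1 q + [:y ^ q:]"
  proof (rule poly_eqI_degree_lead_coeff[where n = q and A = F])
    have deg: "Polynomial.degree ([:y, 1:] ^ q) = q" by (simp add: degree_power_eq)
    then show "Polynomial.degree ([:y, 1:] ^ q) \<le> q" by simp
    have "Polynomial.lead_coeff ([:y, 1:] ^ q) = 1" by (simp add: lead_coeff_power)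
    then show "Polynomial.coeff ([:y, 1:] ^ q) q = Polynomial.coeff (Polynomial.monom 1 q + [:y ^ q:]) q"
      using deg q2 by (simp add: coeff_pCons split: nat.splits)
    show "Polynomial.degree (Polynomial.monom 1 q + [:y ^ q:]) \<le> q"
      by (intro degree_add_le) (auto simp: degree_monom_le)
    show "poly ([:y, 1:] ^ q) c = poly (Polynomial.monom 1 q + [:y ^ q:]) c" if "c \<in> F" for c
      using translate[OF that] by (simp add: poly_power poly_monom add.commute)
  qed (simp_all add: F)
  from arg_cong[OF this, of "\<lambda>p. poly p x"] show ?thesis
    by (simp add: poly_power poly_monom add.commute)
qed

section \<open>The field with q^l elements\<close>

text \<open>For l > 0 this is the field with q^l elements; for l = 0 it is the whole closure. It is
  a set and not a type because its size depends on the variable l.\<close>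

definition subfield_of_degree :: "nat \<Rightarrow> 'a::{field,finite} alg_closure set" where
  "subfield_of_degree l = {x. x ^ (CARD('a) ^ l) = x}"

lemma power_card_power_add:
  fixes x y :: "'a::{field,finite} alg_closure"
  shows "(x + y) ^ (CARD('a) ^ l) = x ^ (CARD('a) ^ l) + y ^ (CARD('a) ^ l)"
proof (induction l)
  case (Suc l)
  then show ?case by (simp add: power_mult power_card_add mult.commute[of "CARD('a)"])
qed simp

lemma subfield_of_degree_mult:
  "x \<in> subfield_of_degree l \<Longrightarrow> y \<in> subfield_of_degree l \<Longrightarrow> x * y \<in> subfield_of_degree l"
  by (simp add: subfield_of_degree_def power_mult_distrib)

lemma subfield_of_degree_add:
  "x \<in> subfield_of_degree l \<Longrightarrow> y \<in> subfield_of_degree l \<Longrightarrow> x + y \<in> subfield_of_degree l"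
  by (simp add: subfield_of_degree_def power_card_power_add)

lemma to_ac_in_subfield: "to_ac c \<in> subfield_of_degree l"
proof -
  have "c ^ (CARD('a) ^ l) = c" for c :: 'a
    by (induction l) (simp_all add: power_mult finite_field_power_card)
  then show ?thesis by (simp add: subfield_of_degree_def flip: to_ac_power)
qed

text \<open>With Q = q^l, the polynomial X^Q - X splits over the algebraic closure and has
  derivative -1, so its Q roots are distinct.\<close>

lemma card_subfield_of_degree:
  fixes l :: nat
  defines "K \<equiv> subfield_of_degree l :: 'a::{field,finite} alg_closure set"
  assumes "l > 0"
  shows "finite K" and "card K = CARD('a) ^ l"
proof -
  define Q where "Q = CARD('a) ^ l"
  define p where "p = Polynomial.monom 1 Q - [:0, 1 :: 'a alg_closure:]"
  have Q2: "Q \<ge> 2"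
    using card_field_ge_2[where 'a = 'a] self_le_power[of "CARD('a)" l] assms by (simp add: Q_def)
  have deg: "Polynomial.degree p = Q"
  proof -
    have "Polynomial.degree (- [:0, 1 :: 'a alg_closure:]) < Polynomial.degree (Polynomial.monom (1 :: 'a alg_closure) Q)"
      using Q2 by (simp add: degree_monom_eq)
    from degree_add_eq_left[OF this] show ?thesis
      by (simp only: p_def diff_conv_add_uminus degree_monom_eq[OF one_neq_zero])
  qed
  then have p0: "p \<noteq> 0" using Q2 by auto
  have K: "K = {x. poly p x = 0}"
    by (auto simp: K_def subfield_of_degree_def p_def poly_monom Q_def)
  \<comment> \<open>Thus the leading term of the derivative vanishes.\<close>
  have "of_nat Q = (0 :: 'a alg_closure)"
  proof -
    have "of_nat CARD('a) = (0 :: 'a alg_closure)"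
      using of_nat_card_eq_0[where 'a = 'a] by (metis to_ac_0 to_ac_of_nat)
    then show ?thesis using assms by (simp add: Q_def)
  qed
  then have "poly (pderiv p) a = - 1" for a
    by (simp add: p_def pderiv_diff pderiv_monom pderiv_pCons poly_monom)
  moreover have "poly (pderiv p) a = 0" if "Polynomial.order a p \<ge> 2" for a
  proof -
    have "[:-a, 1:]\<^sup>2 dvd p"
      using that by (meson dvd_trans le_imp_power_dvd order_1)
    then obtain r where r: "p = [:-a, 1:] * ([:-a, 1:] * r)"
      unfolding power2_eq_square mult.assoc[symmetric] by (elim dvdE)
    show ?thesis
      unfolding r pderiv_mult[of "[:-a, 1:]"] by (simp del: mult_pCons_left)
  qed
  ultimately have ord: "Polynomial.order a p \<le> 1" for a
    by (metis neg_equal_0_iff_equal not_less_eq_eq numeral_2_eq_2 One_nat_def zero_neq_one)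
  obtain A where A: "size A = Polynomial.degree p" "p = Polynomial.smult (Polynomial.lead_coeff p) (\<Prod>x\<in>#A. [:-x, 1:])"
    using alg_closed_imp_factorization[OF p0] by blast
  \<comment> \<open>Counted with multiplicity, the roots are those of the factorization, so their
    number is the degree.\<close>
  have "proots p = proots (\<Prod>x\<in>#A. [:-x, 1:])"
    using p0 by (subst A(2)) simp
  also have "\<dots> = A"
  proof (induction A)
    case (add x A)
    have "[:-x, 1:] * (\<Prod>y\<in>#A. [:-y, 1:]) \<noteq> 0"
      by (auto simp: prod_mset_zero_iff simp del: mult_pCons_left)
    then show ?case
      using add.IH by (simp add: proots_mult del: mult_pCons_left)
  qed simp
  finally have "size (proots p) = Q" using A deg by simp
  moreover have "size (proots p) = (\<Sum>x\<in>set_mset (proots p). 1)"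
    unfolding size_multiset_overloaded_eq
  proof (rule sum.cong)
    fix x assume "x \<in># proots p"
    then have "count (proots p) x > 0" by simp
    moreover have "count (proots p) x = Polynomial.order x p" using p0 by simp
    ultimately show "count (proots p) x = 1" using ord[of x] by linarith
  qed simp
  moreover have "set_mset (proots p) = K" using p0 K by simp
  ultimately show "card K = CARD('a) ^ l" by (simp add: Q_def)
  show "finite K" unfolding \<open>set_mset (proots p) = K\<close>[symmetric] by simp
qed

text \<open>Scalars act through the embedding \<open>to_ac\<close>; this provides bases of the
  subfields over F_q.\<close>

interpretation ac: vector_space "\<lambda>(c :: 'a::field) (x :: 'a alg_closure). to_ac c * x"
  by standard (simp_all add: algebra_simps)

text \<open>The length of a basis is read off from the cardinality q^l of the subfield.\<close>

lemma subfield_basis: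
  fixes l :: nat
  defines "K \<equiv> subfield_of_degree l :: 'a::{field,finite} alg_closure set"
  assumes "l > 0"
  obtains B where "B \<subseteq> K" "finite B" "card B = l" "ac.independent B" "ac.span B = K"
proof -
  have sub: "ac.subspace K"
  proof (rule ac.subspaceI)
    show "0 \<in> K" using to_ac_in_subfield[of 0 l] by (simp add: K_def)
  qed (auto simp: K_def subfield_of_degree_add subfield_of_degree_mult to_ac_in_subfield)
  obtain B where B: "B \<subseteq> K" "ac.independent B" "K \<subseteq> ac.span B"
    using ac.basis_exists[of K] by metis
  have K: "finite K" "card K = CARD('a) ^ l"
    using card_subfield_of_degree[OF assms(2), where 'a = 'a] by (simp_all add: K_def)
  have finB: "finite B" using B(1) K(1) by (rule finite_subset)
  have span: "ac.span B = K"
    using B sub ac.span_minimal by blast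
  have "CARD('a) ^ card B = CARD('a) ^ l"
    using ac.card_span_independent[OF _ finB B(2)] K span by simp
  then have "card B = l"
    using card_field_ge_2[where 'a = 'a] by (simp add: power_inject_exp)
  then show ?thesis using that B finB span by blast
qed

section \<open>Partial spreads from field multiplication\<close>

text \<open>The coordinates are split into a set \<open>A\<close> of size j and its complement of
  size l. Both parts are mapped linearly into the field \<open>K\<close> with q^l elements, the
  first injectively, the second bijectively. \<open>P x\<close> is the graph of multiplication by
  \<open>x\<close>, and \<open>Q\<close> is the vertical axis. Two graphs meet only in 0 because a
  field has no zero divisors.\<close>

lemma exists_partial_spread:
  fixes j l :: nat
  assumes "j + l = CARD('n)" "j \<le> l" "l > 0"
  obtains I :: "'a::{field,finite} alg_closure set" and P and Q :: "('a ^ 'n) set"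
  where "finite I" "card I = CARD('a) ^ l" "Q \<in> level l"
    and "\<And>x. x \<in> I \<Longrightarrow> P x \<in> level j" and "\<And>x. x \<in> I \<Longrightarrow> P x \<inter> Q = {0}"
    and "\<And>x y. x \<in> I \<Longrightarrow> y \<in> I \<Longrightarrow> x \<noteq> y \<Longrightarrow> P x \<inter> P y = {0}"
proof -
  define K :: "'a alg_closure set" where "K = subfield_of_degree l"
  obtain B where B: "B \<subseteq> K" "finite B" "card B = l" "ac.independent B" "ac.span B = K"
    using subfield_basis[OF \<open>l > 0\<close>] unfolding K_def by metis
  obtain A :: "'n set" where A: "card A = j"
    using obtain_subset_with_card_n[of j "UNIV :: 'n set"] assms by auto
  have cA: "card (- A) = l" using A assms by (simp add: Compl_eq_Diff_UNIV card_Diff_subset)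
  \<comment> \<open>Here j \<le> l is needed: the basis must have room for \<open>A\<close>.\<close>
  obtain e1 where e1: "inj_on e1 A" "e1 ` A \<subseteq> B"
    using card_le_inj[of A B] A B assms by auto
  obtain e2 where e2: "bij_betw e2 (- A) B"
    using finite_same_card_bij[of "- A" B] B cA by auto
  define e where "e i = (if i \<in> A then e1 i else e2 i)" for i
  have eA: "inj_on e A" "e ` A \<subseteq> B" using e1 by (auto simp: e_def inj_on_def)
  have eB: "inj_on e (- A)" "e ` (- A) = B"
    using e2 by (auto simp: e_def inj_on_def bij_betw_def)
  define S where "S I v = (\<Sum>i\<in>I. to_ac (v $ i) * e i)" for I :: "'n set" and v :: "'a ^ 'n"
  have S_zero: "v $ i = 0" if I: "inj_on e I" "e ` I \<subseteq> B" and "S I v = 0" "i \<in> I"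
    for I and v :: "'a ^ 'n" and i
  proof -
    have "S I v = (\<Sum>b\<in>e ` I. to_ac (v $ the_inv_into I e b) * b)"
      unfolding S_def by (subst sum.reindex[OF I(1)]) (simp add: the_inv_into_f_f[OF I(1)])
    then have "v $ the_inv_into I e (e i) = 0"
      using ac.independentD[OF B(4), of "e ` I" "\<lambda>b. v $ the_inv_into I e b" "e i"] that by simp
    then show ?thesis using the_inv_into_f_f[OF I(1)] that by simp
  qed
  have S_in: "S A v \<in> K" for v
    unfolding S_def B(5)[symmetric] using eA by (intro ac.span_sum ac.span_scale ac.span_base) auto
  \<comment> \<open>Any second component in \<open>K\<close> can be combined with any coordinates on
    \<open>A\<close>.\<close>
  have S_surj: "\<exists>u. S (- A) u = y \<and> (\<forall>i\<in>A. u $ i = v $ i)" if "y \<in> K"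
    for y and v :: "'a ^ 'n"
  proof -
    have "y \<in> range (\<lambda>c. \<Sum>b\<in>B. to_ac (c b) * b)"
      using that by (simp add: ac.span_finite[OF B(2)] flip: B(5))
    then obtain c where c: "y = (\<Sum>b\<in>B. to_ac (c b) * b)" by (elim imageE)
    let ?u = "\<chi> i. if i \<in> A then v $ i else c (e i)"
    have "S (- A) ?u = (\<Sum>i\<in>- A. to_ac (c (e i)) * e i)"
      unfolding S_def by (intro sum.cong) auto
    also have "\<dots> = y"
      unfolding c eB(2)[symmetric] by (simp add: sum.reindex[OF eB(1)])
    finally show ?thesis by (intro exI[of _ ?u]) auto
  qed
  have S_linear: "S I (u + v) = S I u + S I v" "S I (c *s u) = to_ac c * S I u" "S I 0 = 0"
    "S I (u - v) = S I u - S I v" for I u v c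
    by (simp_all add: S_def sum.distrib sum_subtractf sum_distrib_left algebra_simps)
  define Q :: "('a ^ 'n) set" where "Q = {v. \<forall>i\<in>A. v $ i = 0}"
  define P where "P x = {v. S (- A) v = x * S A v}" for x
  have Q: "vec.subspace Q" "vec.dim Q = l"
  proof -
    show "vec.subspace Q" by (rule vec.subspaceI) (auto simp: Q_def)
    show "vec.dim Q = l"
      using dim_substandard_cart[of "- A", where 'a = 'a] cA by (simp add: Q_def Ball_def)
  qed
  have P: "vec.subspace (P x)" for x
    by (rule vec.subspaceI) (auto simp: P_def S_linear algebra_simps)
  have PQ: "P x \<inter> Q = {0}" for x
  proof -
    have "v = 0" if "v \<in> P x" "v \<in> Q" for v
    proof -
      have "S A v = 0" using that by (simp add: Q_def S_def)
      then have "S (- A) v = 0" using that by (simp add: P_def)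
      then have "v $ i = 0" for i
        using S_zero[of "- A" v i] eB that by (cases "i \<in> A") (auto simp: Q_def)
      then show ?thesis by (simp add: vec_eq_iff)
    qed
    then show ?thesis using vec.subspace_0[OF P] vec.subspace_0[OF Q(1)] by auto
  qed
  have PP: "P x \<inter> P y = {0}" if "x \<noteq> y" for x y
  proof -
    have "v = 0" if v: "v \<in> P x" "v \<in> P y" for v
    proof -
      have "x * S A v = y * S A v" using v by (simp add: P_def)
      then have SA: "S A v = 0" using \<open>x \<noteq> y\<close> by simp
      then have "S (- A) v = 0" using v by (simp add: P_def)
      then have "v $ i = 0" for i
        using S_zero[of "- A" v i] S_zero[of A v i] eA eB SA by (cases "i \<in> A") auto
      then show ?thesis by (simp add: vec_eq_iff)
    qed
    then show ?thesis using vec.subspace_0[OF P] by auto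
  qed
  \<comment> \<open>\<open>P x\<close> is a complement of \<open>Q\<close>: changing only
    coordinates outside \<open>A\<close>, that is, adding an element of \<open>Q\<close>, moves any
    vector into the graph.\<close>
  have "vec.dim (P x) = j" if "x \<in> K" for x
  proof -
    have "\<exists>p q. v = p + q \<and> p \<in> P x \<and> q \<in> Q" for v
    proof -
      have "x * S A v \<in> K"
        using that S_in by (simp add: K_def subfield_of_degree_mult)
      then obtain u where u: "S (- A) u = x * S A v" "\<forall>i\<in>A. u $ i = v $ i"
        using S_surj by metis
      then have "S A u = S A v" by (simp add: S_def)
      then have "u \<in> P x" "v - u \<in> Q" using u by (auto simp: P_def Q_def)
      then show ?thesis by (intro exI[of _ u] exI[of _ "v - u"]) auto
    qed
    then have "{p + q |p q. p \<in> P x \<and> q \<in> Q} = UNIV" by blast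
    then show ?thesis
      using vec.dim_sums_Int[OF P[of x] Q(1)] PQ[of x] Q(2) assms(1) by (simp add: card_cart_basis)
  qed
  then show ?thesis
    using card_subfield_of_degree[OF \<open>l > 0\<close>, where 'a = 'a] P Q PP PQ
    by (intro that[of K Q P]) (auto simp: K_def level_def)
qed

section \<open>Averaging over the general linear group\<close>

definition GL :: "('a::field ^ 'n \<Rightarrow> 'a ^ 'n) set" where
  "GL = {g. Vector_Spaces.linear (*s) (*s) g \<and> bij g}"

text \<open>A bijection preserves the cardinality of a subspace, which determines its
  dimension.\<close>

lemma GL_image_level:
  fixes V :: "('a::{field,finite} ^ 'n) set"
  assumes "g \<in> GL" "V \<in> level d"
  shows "g ` V \<in> level d"
proof -
  interpret g: Vector_Spaces.linear "(*s)" "(*s)" g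
    using assms(1) by (simp add: GL_def)
  have V: "vec.subspace V" "vec.dim V = d" using assms(2) by (auto simp: level_def)
  have sub: "vec.subspace (g ` V)" using V(1) by (rule g.subspace_image)
  have "card (g ` V) = card V"
    using assms(1) by (intro card_image) (auto simp: GL_def bij_def intro: inj_on_subset)
  then have "CARD('a) ^ vec.dim (g ` V) = CARD('a) ^ d"
    using card_subspace[OF sub] card_subspace[OF V(1)] V(2) by simp
  then have "vec.dim (g ` V) = d"
    using card_field_ge_2[where 'a = 'a] by (simp add: power_inject_exp)
  then show ?thesis using sub by (simp add: level_def)
qed

text \<open>Bases of \<open>V\<close> and \<open>W\<close> are extended to bases of the whole space,
  and \<open>h\<close> takes one extended basis to the other, respecting the initial parts.\<close>

lemma GL_transitive:
  fixes V W :: "('a::{field,finite} ^ 'n) set"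
  assumes "V \<in> level d" "W \<in> level d"
  obtains h where "h \<in> GL" "h ` V = W"
proof -
  have basis: "\<exists>B C. vec.independent C \<and> B \<subseteq> C \<and> vec.span C = UNIV \<and> vec.span B = U \<and> card B = d"
    if U: "U \<in> level d" for U :: "('a ^ 'n) set"
  proof -
    obtain B where B: "B \<subseteq> U" "vec.independent B" "U \<subseteq> vec.span B" "card B = vec.dim U"
      using vec.basis_exists by blast
    have "vec.span B = U"
      using B U by (auto simp: level_def vec.span_subspace)
    moreover have "card B = d" using B(4) U by (simp add: level_def)
    ultimately show ?thesis
      using vec.independent_extend_basis[OF B(2)] vec.span_extend_basis[OF B(2)]
        vec.extend_basis_superset[OF B(2)] by blast
  qed
  obtain B C where BC: "vec.independent C" "B \<subseteq> C" "vec.span C = UNIV" "vec.span B = V" "card B = d"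
    using basis[OF assms(1)] by blast
  obtain B' C' where BC': "vec.independent C'" "B' \<subseteq> C'" "vec.span C' = UNIV" "vec.span B' = W" "card B' = d"
    using basis[OF assms(2)] by blast
  have "card C = vec.dim (vec.span C)" "card C' = vec.dim (vec.span C')"
    using BC(1) BC'(1) by (simp_all add: vec.dim_span_eq_card_independent del: vec.dim_span)
  then have "card C = card C'" unfolding BC(3) BC'(3) by simp
  moreover have "finite B" "finite B'" by simp_all
  ultimately have "card (C - B) = card (C' - B')"
    using BC(2,5) BC'(2,5) by (simp only: card_Diff_subset)
  then obtain f2 where f2: "bij_betw f2 (C - B) (C' - B')"
    using finite_same_card_bij[of "C - B" "C' - B'"] by auto
  obtain f1 where f1: "bij_betw f1 B B'"
    using finite_same_card_bij[of B B'] BC BC' by auto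
  obtain h where h: "Vector_Spaces.linear (*s) (*s) h"
      "\<And>x. x \<in> C \<Longrightarrow> h x = (if x \<in> B then f1 x else f2 x)"
    using vec.linear_independent_extend[OF BC(1), of "\<lambda>x. if x \<in> B then f1 x else f2 x"] by blast
  interpret h: Vector_Spaces.linear "(*s)" "(*s)" h by fact
  have hB: "h ` B = B'"
  proof -
    have "h ` B = f1 ` B" using h(2) BC(2) by (intro image_cong) auto
    then show ?thesis using f1 by (simp add: bij_betw_def)
  qed
  have hCB: "h ` (C - B) = C' - B'"
  proof -
    have "h ` (C - B) = f2 ` (C - B)" using h(2) by (intro image_cong) auto
    then show ?thesis using f2 by (simp add: bij_betw_def)
  qed
  have "h ` C = C'"
  proof -
    have "h ` C = h ` B \<union> h ` (C - B)" using BC(2) by blast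
    then show ?thesis using BC'(2) by (auto simp: hB hCB)
  qed
  then have "surj h"
    using h.span_image[of C] BC(3) BC'(3) by simp
  then have "h \<in> GL"
    using h(1) finite_UNIV_surj_inj[of h] by (simp add: GL_def bij_def)
  moreover have "h ` V = W"
    using h.span_image[of B] BC(4) BC'(4) hB by simp
  ultimately show ?thesis by (rule that)
qed

lemma GL_comp: "h \<in> GL \<Longrightarrow> g \<in> GL \<Longrightarrow> h \<circ> g \<in> GL"
  by (auto simp: GL_def bij_comp intro: Vector_Spaces.linear_compose)

text \<open>Composition with a map taking \<open>V\<close> to \<open>W\<close> injects the maps from
  \<open>U\<close> onto \<open>V\<close> into those onto \<open>W\<close>. By transitivity the image
  of \<open>U\<close> under a random \<open>g\<close> is therefore uniformly distributed on its
  level.\<close>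

lemma card_GL_image_mem:
  fixes \<F> :: "('a::{field,finite} ^ 'n) set set"
  assumes "U \<in> level d" "\<F> \<subseteq> level d"
  shows "real (card {g \<in> GL. g ` U \<in> \<F>}) = real (card (GL :: ('a ^ 'n \<Rightarrow> 'a ^ 'n) set)) * density d \<F>"
proof -
  let ?c = "\<lambda>V. card {g \<in> GL. g ` U = V}"
  have le: "?c V \<le> ?c W" if VW: "V \<in> level d" "W \<in> level d" for V W
  proof -
    obtain h where h: "h \<in> GL" "h ` V = W" using GL_transitive[OF VW] .
    have "inj_on (\<lambda>g. h \<circ> g) {g \<in> GL. g ` U = V}"
    proof (rule inj_onI, rule ext)
      fix g g' x assume "h \<circ> g = h \<circ> g'"
      then have "h (g x) = h (g' x)" by (metis comp_apply)
      then show "g x = g' x" using h(1) by (simp add: GL_def bij_def inj_eq)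
    qed
    moreover have "(\<lambda>g. h \<circ> g) ` {g \<in> GL. g ` U = V} \<subseteq> {g \<in> GL. g ` U = W}"
      using h by (auto simp: GL_comp image_comp[symmetric])
    ultimately show ?thesis by (intro card_inj_on_le) auto
  qed
  then have const: "?c V = ?c U" if "V \<in> level d" for V
    using that assms(1) by (intro antisym) auto
  have count: "card {g \<in> GL. g ` U \<in> \<G>} = card \<G> * ?c U" if G: "\<G> \<subseteq> level d" for \<G>
  proof -
    have "{g \<in> GL. g ` U \<in> \<G>} = (\<Union>V\<in>\<G>. {g \<in> GL. g ` U = V})" by auto
    then have "card {g \<in> GL. g ` U \<in> \<G>} = (\<Sum>V\<in>\<G>. ?c V)"
      by (simp only:) (rule card_UN_disjoint, auto)
    also have "\<dots> = (\<Sum>V\<in>\<G>. ?c U)" using G const by (intro sum.cong) auto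
    finally show ?thesis by simp
  qed
  have "{g \<in> GL. g ` U \<in> level d} = GL" using GL_image_level assms(1) by blast
  then have "card (GL :: ('a ^ 'n \<Rightarrow> 'a ^ 'n) set) = card (level d :: ('a ^ 'n) set set) * ?c U"
    using count[of "level d"] by simp
  moreover have "card (level d :: ('a ^ 'n) set set) > 0"
    using assms(1) by (auto simp: card_gt_0_iff)
  ultimately show ?thesis
    using count[OF assms(2)] by (simp add: density_def del: card_0_eq)
qed

lemma intersectingD:
  assumes "intersecting \<F>" "V \<in> \<F>" "W \<in> \<F>" "V \<inter> W \<subseteq> {0}"
  shows "V = W"
proof (rule ccontr)
  assume "V \<noteq> W"
  then have "vec.dim (V \<inter> W) > 0"
    using assms unfolding intersecting_def pairwise_def by blast
  moreover have "vec.dim (V \<inter> W) = 0"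
    using assms(4) by (subst vec.dim_eq_0)
  ultimately show False by simp
qed

lemma partial_spread_averaging:
  fixes \<F> :: "('a::{field,finite} ^ 'n) set set" and P :: "'b \<Rightarrow> ('a ^ 'n) set" and Q :: "('a ^ 'n) set"
  assumes F: "\<F> \<subseteq> level j" "intersecting \<F>" and "j > 0"
    and I: "finite I" and Q: "Q \<in> level l"
    and P: "\<And>x. x \<in> I \<Longrightarrow> P x \<in> level j" "\<And>x. x \<in> I \<Longrightarrow> P x \<inter> Q = {0}"
      "\<And>x y. x \<in> I \<Longrightarrow> y \<in> I \<Longrightarrow> x \<noteq> y \<Longrightarrow> P x \<inter> P y = {0}"
  shows "real (card I) * density j \<F> + density l (up_level l \<F>) \<le> 1"
proof -
  let ?S = "up_level l \<F>" and ?GL = "GL :: ('a ^ 'n \<Rightarrow> 'a ^ 'n) set"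
  have S: "?S \<subseteq> level l" by (auto simp: up_level_def)
  \<comment> \<open>\<open>intersecting\<close> compares distinct members only, so a trivial
    intersection first yields equality; this fact then refutes the equality.\<close>
  have nontriv: "\<not> V \<subseteq> {0}" if "V \<in> level j" for V :: "('a ^ 'n) set"
    using that \<open>j > 0\<close> vec.dim_eq_0[of V] unfolding level_def by simp
  have disj: "g ` U \<inter> g ` W \<subseteq> {0}" if g: "g \<in> GL" and "U \<inter> W = {0}" for g and U W :: "('a ^ 'n) set"
  proof -
    interpret g: Vector_Spaces.linear "(*s)" "(*s)" g using g by (simp add: GL_def)
    have "g ` U \<inter> g ` W = g ` (U \<inter> W)"
      using g by (simp add: GL_def bij_def image_Int)
    then show ?thesis using that by (simp add: g.zero)
  qed
  have one: "card {x \<in> I. g ` P x \<in> \<F>} + (if g ` Q \<in> ?S then 1 else 0) \<le> 1" if g: "g \<in> GL" for g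
  proof -
    have "x = y" if xy: "x \<in> I" "y \<in> I" "g ` P x \<in> \<F>" "g ` P y \<in> \<F>" for x y
    proof (rule ccontr)
      assume "x \<noteq> y"
      then have d: "g ` P x \<inter> g ` P y \<subseteq> {0}" using disj[OF g P(3)] xy by blast
      then have "g ` P x = g ` P y" using intersectingD[OF F(2)] xy by blast
      then show False using d nontriv[of "g ` P x"] F(1) xy by auto
    qed
    then have c1: "card {x \<in> I. g ` P x \<in> \<F>} \<le> 1"
      using I by (auto simp: card_le_Suc0_iff_eq)
    \<comment> \<open>A member inside the image of \<open>Q\<close> meets the image of
      \<open>P x\<close> trivially, so the two cannot both belong to the family.\<close>
    have "g ` P x \<notin> \<F>" if gx: "g ` Q \<in> ?S" "x \<in> I" for x
    proof
      assume x: "g ` P x \<in> \<F>"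
      obtain V where V: "V \<in> \<F>" "V \<subseteq> g ` Q" using gx(1) by (auto simp: up_level_def)
      have d: "g ` P x \<inter> V \<subseteq> {0}" using disj[OF g P(2)[OF gx(2)]] V by blast
      then have "g ` P x = V" using intersectingD[OF F(2)] x V by blast
      then show False using d nontriv[of V] F(1) V by auto
    qed
    then have e: "{x \<in> I. g ` P x \<in> \<F>} = {}" if "g ` Q \<in> ?S" using that by blast
    show ?thesis
    proof (cases "g ` Q \<in> ?S")
      case True
      then show ?thesis unfolding e[OF True] by simp
    next
      case False
      then show ?thesis using c1 by simp
    qed
  qed
  \<comment> \<open>Double counting of the pairs of \<open>g\<close> and \<open>x\<close>.\<close>
  have "(\<Sum>g\<in>?GL. card {x \<in> I. g ` P x \<in> \<F>}) = (\<Sum>x\<in>I. card {g \<in> ?GL. g ` P x \<in> \<F>})"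
    using sum.swap_restrict[of ?GL I "\<lambda>_ _. 1 :: nat" "\<lambda>g x. g ` P x \<in> \<F>"] I by simp
  moreover have "(\<Sum>g\<in>?GL. if g ` Q \<in> ?S then 1 else 0) = card {g \<in> ?GL. g ` Q \<in> ?S}"
    by (simp flip: sum.inter_filter)
  ultimately have "(\<Sum>x\<in>I. card {g \<in> ?GL. g ` P x \<in> \<F>}) + card {g \<in> ?GL. g ` Q \<in> ?S}
      = (\<Sum>g\<in>?GL. card {x \<in> I. g ` P x \<in> \<F>} + (if g ` Q \<in> ?S then 1 else 0))"
    by (simp add: sum.distrib)
  also have "\<dots> \<le> (\<Sum>g\<in>?GL. 1)" by (intro sum_mono one)
  finally have "real ((\<Sum>x\<in>I. card {g \<in> ?GL. g ` P x \<in> \<F>}) + card {g \<in> ?GL. g ` Q \<in> ?S}) \<le> real (card ?GL)"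
    by (simp only: of_nat_le_iff card_eq_sum)
  then have "(\<Sum>x\<in>I. real (card {g \<in> ?GL. g ` P x \<in> \<F>})) + real (card {g \<in> ?GL. g ` Q \<in> ?S}) \<le> real (card ?GL)"
    by simp
  then have "real (card ?GL) * (real (card I) * density j \<F> + density l ?S) \<le> real (card ?GL) * 1"
    using card_GL_image_mem[OF P(1) F(1)] card_GL_image_mem[OF Q S]
    by (simp add: algebra_simps)
  moreover have "card ?GL > 0"
  proof -
    have "id \<in> ?GL" by (simp add: GL_def vec.linear_id)
    then show ?thesis by (auto simp: card_gt_0_iff)
  qed
  ultimately show ?thesis by (simp del: card_0_eq)
qed

section \<open>Intersecting antichains and Sperner families\<close>

text \<open>The bound is attained by all j-subspaces through a point. Above it, the shadow in
  dimension l = n - j exceeds [l]/[n], which contradicts \<open>partial_spread_averaging\<close>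
  because q^l [j] + [l] = [n].\<close>

lemma Erdos_Ko_Rado:
  fixes \<F> :: "('a::{field,finite} ^ 'n) set set"
  assumes F: "\<F> \<subseteq> level j" "intersecting \<F>" and j: "0 < j" "2 * j \<le> CARD('n)"
  shows "density j \<F> \<le> qnum CARD('a) j / qnum CARD('a) CARD('n)"
proof (rule ccontr)
  let ?n = "CARD('n)" and ?q = "CARD('a)"
  define l where "l = ?n - j"
  have l: "j + l = ?n" "j \<le> l" "0 < l" "l < ?n" using j by (auto simp: l_def)
  assume "\<not> ?thesis"
  then have gr: "density j \<F> > qnum ?q j / qnum ?q ?n" by simp
  then have gr': "density l (up_level l \<F>) > qnum ?q l / qnum ?q ?n"
    using up_level_greater[of j l \<F>] j l F by simp
  obtain I :: "'a alg_closure set" and P :: "'a alg_closure \<Rightarrow> ('a ^ 'n) set" and Q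
    where "finite I" "card I = ?q ^ l" "Q \<in> level l"
    and "\<And>x. x \<in> I \<Longrightarrow> P x \<in> level j" and "\<And>x. x \<in> I \<Longrightarrow> P x \<inter> Q = {0}"
    and "\<And>x y. x \<in> I \<Longrightarrow> y \<in> I \<Longrightarrow> x \<noteq> y \<Longrightarrow> P x \<inter> P y = {0}"
    by (rule exists_partial_spread[OF l(1,2,3), where 'a = 'a]) (rule that)
  then have "real (?q ^ l) * density j \<F> + density l (up_level l \<F>) \<le> 1"
    using partial_spread_averaging[OF F j(1), of I Q l P] by simp
  moreover have "real (?q ^ l) * (qnum ?q j / qnum ?q ?n) + qnum ?q l / qnum ?q ?n = 1"
  proof -
    have "qnum ?q ?n = qnum ?q l + real ?q ^ l * qnum ?q j"
      using qnum_add[of ?q l j] l(1) by (simp add: add.commute)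
    moreover have "qnum ?q ?n > 0" by (rule qnum_pos) simp
    moreover have "real (?q ^ l) * (qnum ?q j / qnum ?q ?n) + qnum ?q l / qnum ?q ?n
        = (qnum ?q l + real ?q ^ l * qnum ?q j) / qnum ?q ?n"
      by (simp add: add_divide_distrib)
    ultimately show ?thesis by simp
  qed
  moreover have "real (?q ^ l) * (qnum ?q j / qnum ?q ?n) \<le> real (?q ^ l) * density j \<F>"
    using gr by (intro mult_left_mono) auto
  ultimately show False using gr' by linarith
qed

text \<open>Distinct members of \<open>\<B>\<close> may lie above the same member of
  \<open>\<A>\<close>; the positive dimensions cover that case.\<close>

lemma intersecting_superset:
  fixes \<A> \<B> :: "('a::field ^ 'n) set set"
  assumes "intersecting \<A>" and "\<And>V. V \<in> \<A> \<Longrightarrow> vec.dim V > 0"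
    and "\<And>W. W \<in> \<B> \<Longrightarrow> \<exists>V\<in>\<A>. V \<subseteq> W"
  shows "intersecting \<B>"
  unfolding intersecting_def
proof (rule pairwiseI)
  fix W W' assume "W \<in> \<B>" "W' \<in> \<B>"
  then obtain V V' where V: "V \<in> \<A>" "V \<subseteq> W" "V' \<in> \<A>" "V' \<subseteq> W'"
    using assms(3) by meson
  then have "vec.dim (V \<inter> V') > 0"
    using assms(1,2) by (cases "V = V'") (auto simp: intersecting_def pairwise_def)
  moreover have "vec.dim (V \<inter> V') \<le> vec.dim (W \<inter> W')"
    using V by (intro vec.dim_subset) auto
  ultimately show "vec.dim (W \<inter> W') > 0" by simp
qed

lemma dim_level_subset_level:
  "(\<And>V. V \<in> \<A> \<Longrightarrow> vec.subspace V) \<Longrightarrow> dim_level \<A> j \<subseteq> level j"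
  by (auto simp: dim_level_def level_def)

text \<open>Downward induction on the lower bound d for the dimensions. The terms are those of the
  final sum divided by [n], whence the right side.\<close>

lemma antichain_LYM:
  fixes \<A> :: "('a::{field,finite} ^ 'n) set set" and d m :: nat
  assumes "d \<le> m" "0 < d" "2 * m \<le> CARD('n)"
    and "intersecting \<A>"
    and "\<And>V W. V \<in> \<A> \<Longrightarrow> W \<in> \<A> \<Longrightarrow> V \<subseteq> W \<Longrightarrow> V = W"
    and "\<And>V. V \<in> \<A> \<Longrightarrow> vec.subspace V"
    and "\<And>V. V \<in> \<A> \<Longrightarrow> d \<le> vec.dim V"
  shows "(\<Sum>j=d..m. density j (dim_level \<A> j) / qnum CARD('a) j) \<le> 1 / qnum CARD('a) CARD('n)"
  using assms(1,2,4-7)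
proof (induction d arbitrary: \<A> rule: inc_induct)
  case base
  have "intersecting (dim_level \<A> m)"
    using base.prems by (auto simp: intersecting_def pairwise_def dim_level_def)
  then have "density m (dim_level \<A> m) \<le> qnum CARD('a) m / qnum CARD('a) CARD('n)"
    using Erdos_Ko_Rado dim_level_subset_level base.prems assms(3) by metis
  then have "density m (dim_level \<A> m) / qnum CARD('a) m
      \<le> qnum CARD('a) m / qnum CARD('a) CARD('n) / qnum CARD('a) m"
    by (intro divide_right_mono) auto
  then show ?case using qnum_pos[OF \<open>0 < m\<close>, of "CARD('a)"] by simp
next
  case (step d)
  let ?q = "CARD('a)"
  define F where "F = dim_level \<A> d"
  define S where "S = up_level (Suc d) F"
  define \<B> where "\<B> = (\<A> - F) \<union> S"
  have F: "F \<subseteq> level d" "F \<subseteq> \<A>"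
    using dim_level_subset_level[of \<A> d] step.prems(4) by (auto simp: F_def dim_level_def)
  have S: "S \<subseteq> level (Suc d)" by (auto simp: S_def up_level_def)
  have AF: "V \<in> \<A> \<Longrightarrow> V \<notin> F \<Longrightarrow> Suc d \<le> vec.dim V" for V
    using step.prems(5)[of V] by (auto simp: F_def dim_level_def)
  \<comment> \<open>By the antichain property the shadow is disjoint from the remaining members, so
    that its density is simply added on level d + 1.\<close>
  have not_S: "V \<notin> S" if "V \<in> \<A>" "V \<notin> F" for V
  proof
    assume "V \<in> S"
    then obtain V0 where "V0 \<in> F" "V0 \<subseteq> V" by (auto simp: S_def up_level_def)
    then show False using step.prems(3)[of V0 V] F that by auto
  qed
  have "intersecting F" using step.prems(2) F(2) by (auto simp: intersecting_def intro: pairwise_mono)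
  then have "density d F \<le> qnum ?q d / qnum ?q CARD('n)"
    using F(1) step.prems(1) step.hyps assms(3) by (intro Erdos_Ko_Rado) auto
  then have shadow: "density d F / qnum ?q d \<le> density (Suc d) S / qnum ?q (Suc d)"
    unfolding S_def using F(1) step.prems(1) step.hyps assms(3) by (intro density_up_level_le) auto
  have "(\<Sum>j=Suc d..m. density j (dim_level \<B> j) / qnum ?q j) \<le> 1 / qnum ?q CARD('n)"
  proof (rule step.IH)
    show "intersecting \<B>"
    proof (rule intersecting_superset[OF step.prems(2)])
      show "vec.dim V > 0" if "V \<in> \<A>" for V using step.prems(1) step.prems(5)[OF that] by simp
      show "\<exists>V\<in>\<A>. V \<subseteq> W" if "W \<in> \<B>" for W
        using that F(2) by (auto simp: \<B>_def S_def up_level_def)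
    qed
    show "vec.subspace V" if "V \<in> \<B>" for V
      using that step.prems(4) S by (auto simp: \<B>_def level_def)
    show dim: "Suc d \<le> vec.dim V" if "V \<in> \<B>" for V
      using that AF S by (auto simp: \<B>_def level_def)
    \<comment> \<open>If \<open>W\<close> is in the shadow, it has the least dimension occurring in
      \<open>\<B>\<close>, and so has \<open>V\<close>. If only \<open>V\<close> is, a member of
      \<open>F\<close> below \<open>V\<close> would lie below the old member
      \<open>W\<close>.\<close>
    show "V = W" if "V \<in> \<B>" "W \<in> \<B>" "V \<subseteq> W" for V W
    proof (cases "W \<in> S")
      case True
      then have "V \<in> level (Suc d)"
        using that dim[of V] S vec.dim_subset[OF that(3)] step.prems(4) by (auto simp: \<B>_def level_def)
      then show ?thesis using True S that by (intro level_eqI) auto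
    next
      case False
      then have W: "W \<in> \<A>" "W \<notin> F" using that by (auto simp: \<B>_def)
      show ?thesis
      proof (cases "V \<in> S")
        case True
        then obtain V0 where "V0 \<in> F" "V0 \<subseteq> V" by (auto simp: S_def up_level_def)
        then show ?thesis using step.prems(3)[of V0 W] W F(2) that by auto
      next
        case False
        then show ?thesis using step.prems(3)[of V W] W that by (auto simp: \<B>_def)
      qed
    qed
  qed simp
  moreover have "density j (dim_level \<B> j) / qnum ?q j = density j (dim_level \<A> j) / qnum ?q j
      + (if j = Suc d then density (Suc d) S / qnum ?q (Suc d) else 0)" if "j \<in> {Suc d..m}" for j
  proof (cases "j = Suc d")
    case True
    have "dim_level \<B> (Suc d) = dim_level \<A> (Suc d) \<union> S"
      using S by (auto simp: \<B>_def dim_level_def level_def F_def)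
    moreover have "dim_level \<A> (Suc d) \<inter> S = {}"
      using not_S by (auto simp: dim_level_def F_def)
    ultimately show ?thesis
      using True by (simp add: density_def card_Un_disjoint add_divide_distrib)
  next
    case False
    then have "dim_level \<B> j = dim_level \<A> j"
      using S that by (auto simp: \<B>_def dim_level_def level_def F_def)
    then show ?thesis using False by simp
  qed
  ultimately have "(\<Sum>j=Suc d..m. density j (dim_level \<A> j) / qnum ?q j)
      + density (Suc d) S / qnum ?q (Suc d) \<le> 1 / qnum ?q CARD('n)"
    using step.hyps by (simp add: sum.distrib sum.delta)
  then show ?case
    using shadow step.hyps by (subst sum.atLeast_Suc_atMost) (auto simp: F_def)
qed

text \<open>The minimal members form an antichain. A chain of nonminimal members can be prolonged
  downwards by a member of the family, so removing the minimal members lowers k by one.\<close>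

lemma k_Sperner_weight:
  fixes \<V> :: "'b set set" and w :: "'b set \<Rightarrow> real"
  assumes "finite \<V>" "k_Sperner k \<V>"
    and "\<And>\<A>. \<A> \<subseteq> \<V> \<Longrightarrow> (\<And>V W. V \<in> \<A> \<Longrightarrow> W \<in> \<A> \<Longrightarrow> V \<subseteq> W \<Longrightarrow> V = W)
      \<Longrightarrow> (\<Sum>V\<in>\<A>. w V) \<le> 1"
  shows "(\<Sum>V\<in>\<V>. w V) \<le> real k"
  using assms
proof (induction k arbitrary: \<V>)
  case 0
  have "\<V> = {}"
  proof (rule ccontr)
    assume "\<V> \<noteq> {}"
    then obtain V where "V \<in> \<V>" by blast
    then have "{V} \<in> chains \<V>" by (auto simp: chains_def chain_subset_def)
    then show False using 0(2) by (auto simp: k_Sperner_def)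
  qed
  then show ?case by simp
next
  case (Suc k)
  define M where "M = {V \<in> \<V>. \<forall>W\<in>\<V>. W \<subseteq> V \<longrightarrow> W = V}"
  have "k_Sperner k (\<V> - M)"
    unfolding k_Sperner_def
  proof
    fix \<C> assume C: "\<C> \<in> chains (\<V> - M)"
    then have sub: "\<C> \<subseteq> \<V> - M" and chain: "\<And>x y. x \<in> \<C> \<Longrightarrow> y \<in> \<C> \<Longrightarrow> x \<subseteq> y \<or> y \<subseteq> x"
      by (auto simp: chains_def chain_subset_def)
    have fin: "finite \<C>" using sub Suc.prems(1) by (meson Diff_subset finite_subset)
    have "card \<C> \<le> k"
    proof (cases "\<C> = {}")
      case False
      obtain V where V: "V \<in> \<C>" "\<And>W. W \<in> \<C> \<Longrightarrow> W \<subseteq> V \<Longrightarrow> W = V"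
        using finite_has_minimal[OF fin False] by metis
      \<comment> \<open>The bottom \<open>V\<close> of the chain is not minimal in
        \<open>\<V>\<close>, so some \<open>U\<close> lies strictly below the whole chain.\<close>
      obtain U where U: "U \<in> \<V>" "U \<subseteq> V" "U \<noteq> V" using V(1) sub by (auto simp: M_def)
      have UC: "U \<subseteq> W" if "W \<in> \<C>" for W
        using chain[OF V(1) that] V(2)[OF that] U by blast
      have "U \<notin> \<C>" using V(2) U by blast
      have "insert U \<C> \<in> chains \<V>"
        using sub chain UC U(1) by (auto simp: chains_def chain_subset_def)
      then have "card (insert U \<C>) \<le> Suc k" using Suc.prems(2) by (auto simp: k_Sperner_def)
      then show ?thesis using fin \<open>U \<notin> \<C>\<close> by simp
    qed simp
    then show "finite \<C> \<and> card \<C> \<le> k" using fin by simp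
  qed
  then have "(\<Sum>V\<in>\<V> - M. w V) \<le> real k"
    using Suc.prems(1,3) by (intro Suc.IH) (auto simp: subset_iff)
  moreover have "(\<Sum>V\<in>M. w V) \<le> 1" by (rule Suc.prems(3)) (auto simp: M_def)
  moreover have "(\<Sum>V\<in>\<V>. w V) = (\<Sum>V\<in>\<V> - M. w V) + (\<Sum>V\<in>M. w V)"
    using Suc.prems(1) by (intro sum.subset_diff) (auto simp: M_def)
  ultimately show ?case by simp
qed

section \<open>Gaussian coefficients and the numbers of subspaces\<close>

text \<open>Cancelling q - 1 turns the coefficient into a quotient of products of
  \<open>qnum\<close>. The recursion is that of \<open>card_level_Suc\<close>.\<close>

lemma gauss_coeff_Suc:
  assumes "q \<ge> 2"
  shows "gauss_coeff q n (Suc k) * qnum q (Suc k) = gauss_coeff q n k * qnum q (n - k)"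
proof -
  have q: "real q - 1 > 0" using assms by simp
  have prod: "gauss_coeff q n k = (\<Prod>i<k. qnum q (n - i)) / (\<Prod>i<k. qnum q (k - i))" for k
  proof -
    have "gauss_coeff q n k = (\<Prod>i<k. qnum q (n - i) / qnum q (k - i))"
      unfolding gauss_coeff_def using q by (intro prod.cong) (simp_all flip: qnum_mult_diff)
    then show ?thesis by (simp add: prod_dividef)
  qed
  have "(\<Prod>i<Suc k. qnum q (Suc k - i)) = qnum q (Suc k) * (\<Prod>i<k. qnum q (k - i))"
    by (subst prod.lessThan_Suc_shift) simp
  then show ?thesis
    unfolding prod using qnum_pos[of "Suc k" q] by simp
qed

text \<open>Splitting off the factor i = 0 expresses the denominators of the theorem by the numbers
  of j-subspaces, up to the factor [j]/[n].\<close>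

lemma gauss_coeff_pred:
  assumes "q \<ge> 2" "0 < k" "0 < n"
  shows "gauss_coeff q n k * qnum q k = gauss_coeff q (n - 1) (k - 1) * qnum q n"
proof -
  obtain k' n' where kn: "k = Suc k'" "n = Suc n'" using assms by (metis gr0_implies_Suc)
  have q: "real q - 1 > 0" using assms by simp
  have "gauss_coeff q n k = (real q ^ n - 1) / (real q ^ k - 1) * gauss_coeff q (n - 1) (k - 1)"
    unfolding gauss_coeff_def kn by (subst prod.lessThan_Suc_shift) simp
  also have "\<dots> = qnum q n / qnum q k * gauss_coeff q (n - 1) (k - 1)"
    using q by (simp flip: qnum_mult_diff)
  finally show ?thesis using qnum_pos[of k q] assms by simp
qed

lemma card_level:
  assumes "d \<le> CARD('n)"
  shows "real (card (level d :: ('a::{field,finite} ^ 'n) set set)) = gauss_coeff CARD('a) CARD('n) d"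
  using assms
proof (induction d)
  case 0
  then show ?case by (simp add: level_0 gauss_coeff_def)
next
  case (Suc d)
  have "real (card (level (Suc d) :: ('a ^ 'n) set set)) * qnum CARD('a) (Suc d)
      = gauss_coeff CARD('a) CARD('n) (Suc d) * qnum CARD('a) (Suc d)"
    using Suc card_level_Suc[of d, where 'a = 'a and 'n = 'n] gauss_coeff_Suc[of "CARD('a)" "CARD('n)" d]
      card_field_ge_2[where 'a = 'a] by simp
  then show ?case using qnum_pos[of "Suc d" "CARD('a)"] by simp
qed

theorem theorem2p4:
  fixes \<V> :: "('a::{field,finite} ^ 'n) set set" and q n k :: nat
  assumes "CARD('a) = q" and "CARD('n) = n"
    and "\<And>V. V \<in> \<V> \<Longrightarrow> vec.subspace V"
    and "intersecting \<V>"
    and "k_Sperner k \<V>"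
    and "\<And>V. V \<in> \<V> \<Longrightarrow> vec.dim V \<le> n div 2"
  shows "(\<Sum>j=1..n div 2. real (card (dim_level \<V> j)) / gauss_coeff q (n - 1) (j - 1)) \<le> real k"
proof -
  define m where "m = n div 2"
  define c where "c j = 1 / gauss_coeff q (n - 1) (j - 1)" for j
  \<comment> \<open>The sum starts at j = 1, so the zero subspace does not contribute, and
    \<open>antichain_LYM\<close> needs positive dimensions.\<close>
  define \<W> where "\<W> = {V \<in> \<V>. 1 \<le> vec.dim V}"
  have q2: "q \<ge> 2" using card_field_ge_2[where 'a = 'a] assms(1) by simp
  have n0: "n > 0" using assms(2) by auto
  have qn: "qnum q n > 0" using n0 by (rule qnum_pos)
  have sum_levels: "(\<Sum>V\<in>\<A>. c (vec.dim V)) = (\<Sum>j=1..m. real (card (dim_level \<A> j)) * c j)"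
    if A: "\<A> \<subseteq> \<W>" for \<A>
  proof -
    have "vec.dim ` \<A> \<subseteq> {1..m}" using A assms(6) by (auto simp: \<W>_def m_def)
    then have "(\<Sum>V\<in>\<A>. c (vec.dim V)) = (\<Sum>j=1..m. \<Sum>V\<in>{V \<in> \<A>. vec.dim V = j}. c (vec.dim V))"
      by (intro sum.group[symmetric]) auto
    then show ?thesis by (simp add: dim_level_def)
  qed
  have c: "real (card F) * c j = density j F / qnum q j * qnum q n" if "j \<in> {1..m}" for j and F :: "('a ^ 'n) set set"
  proof -
    have j: "0 < j" "j \<le> n" using that by (auto simp: m_def)
    let ?N = "gauss_coeff q n j"
    have N: "real (card (level j :: ('a ^ 'n) set set)) = ?N"
      using card_level[of j, where 'a = 'a and 'n = 'n] j assms(1,2) by simp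
    have "?N > 0"
      using card_level_pos[of j, where 'a = 'a and 'n = 'n] j assms(2) by (simp flip: N)
    moreover have "gauss_coeff q (n - 1) (j - 1) = ?N * qnum q j / qnum q n"
      using gauss_coeff_pred[OF q2 j(1) n0] qn by simp
    ultimately show ?thesis
      unfolding c_def density_def N using qnum_pos[OF j(1), of q] qn by simp
  qed
  have "(\<Sum>V\<in>\<W>. c (vec.dim V)) \<le> real k"
  proof (rule k_Sperner_weight)
    show "k_Sperner k \<W>"
      using assms(5) by (auto simp: k_Sperner_def chains_def \<W>_def)
  next
    fix \<A> assume A: "\<A> \<subseteq> \<W>" and anti: "\<And>V W. V \<in> \<A> \<Longrightarrow> W \<in> \<A> \<Longrightarrow> V \<subseteq> W \<Longrightarrow> V = W"
    have "(\<Sum>j=1..m. density j (dim_level \<A> j) / qnum q j) \<le> 1 / qnum q n"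
    \<comment> \<open>The other case is n = 1, where the sum is empty.\<close>
    proof (cases "1 \<le> m")
      case True
      have "intersecting \<A>"
        using assms(4) A by (auto simp: intersecting_def \<W>_def intro: pairwise_mono)
      then show ?thesis
        using antichain_LYM[of 1 m \<A>] True anti A assms(1-3) by (auto simp: \<W>_def m_def)
    qed (use qn in simp)
    then have "(\<Sum>j=1..m. density j (dim_level \<A> j) / qnum q j) * qnum q n \<le> 1"
      using qn by (simp add: field_simps)
    then show "(\<Sum>V\<in>\<A>. c (vec.dim V)) \<le> 1"
      unfolding sum_levels[OF A] by (simp add: c sum_distrib_right)
  qed simp
  moreover have "dim_level \<W> j = dim_level \<V> j" if "j \<in> {1..m}" for j
    using that by (auto simp: dim_level_def \<W>_def)
  ultimately show ?thesis
    using sum_levels[of \<W>] by (simp add: c_def m_def)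
qed

end
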